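(* Let $p\in(0,1)$ be a constant deletion probability. If $x\in\{0,1\}^n$ has at most $k$ entries equal to $1$ and every two consecutive $1$s of $x$ are separated by a run of $0$s of length $\Omega(k\log n)$, then $\mathrm{poly}(n)$ independent traces of $x$ suffice to recover $x$ with high probability.
   Context: The deletion channel with deletion probability $p$ takes $x\in\{0,1\}^n$ and deletes each coordinate independently with probability $p$, outputting the subsequence of surviving coordinates (deletion locations are unknown); each output is a trace. "With high probability" means with probability at least $1-o(1)$ as $n\to\infty$. *)

theory Defs
  imports "HOL-Probability.Probability" "HOL-Probability.Product_PMF" "HOL-Library.Landau_Symbols"
begin

definition trace_pmf :: "real \<Rightarrow> 'a list \<Rightarrow> 'a list pmf" where
  "trace_pmf p x =
     map_pmf (\<lambda>keep. nths x {i. keep i})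
       (Pi_pmf {..<length x} False (\<lambda>_. bernoulli_pmf (1 - p)))"

definition traces_pmf :: "real \<Rightarrow> nat \<Rightarrow> 'a list \<Rightarrow> 'a list list pmf" where
  "traces_pmf p m x = replicate_pmf m (trace_pmf p x)"

definition ones :: "bool list \<Rightarrow> nat set" where
  "ones x = {i. i < length x \<and> x ! i}"

definition consecutive_ones :: "bool list \<Rightarrow> nat \<Rightarrow> nat \<Rightarrow> bool" where
  "consecutive_ones x i j \<longleftrightarrow>
     i \<in> ones x \<and> j \<in> ones x \<and> i < j \<and> (\<forall>l. i < l \<and> l < j \<longrightarrow> l \<notin> ones x)"

text \<open>The positions strictly between consecutive ones form a run of \<open>j - i - 1\<close> zeros.\<close>

definition zero_runs_at_least :: "real \<Rightarrow> bool list \<Rightarrow> bool" where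
  "zero_runs_at_least g x \<longleftrightarrow>
     (\<forall>i j. consecutive_ones x i j \<longrightarrow> g \<le> real (j - i - 1))"

end

theory Submission
  imports Defs
begin

text \<open>
  If any two distinct candidates are told apart by some event whose probabilities under a single
  trace differ by an inverse polynomial in \<open>n\<close>, polynomially many traces and a union bound over
  the at most \<open>2 ^ n\<close> candidates suffice.

  So let \<open>x\<close> and \<open>y\<close> differ, say \<open>a\<close> is the position of a one of \<open>x\<close> but not of \<open>y\<close>. With high
  probability all distances \<open>d\<close> shrink to \<open>(1 - p) d\<close> up to an error of order \<open>sqrt (d ln n)\<close>.
  The gap condition yields a set \<open>\<sigma>\<close> of \<open>O(log n)\<close> ones of \<open>x\<close> containing \<open>a\<close> that is rigid: up
  to errors of this order, \<open>\<sigma>\<close> has no other copy among the ones of \<open>x\<close>. All of \<open>\<sigma>\<close> survives with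
  the inverse polynomial probability \<open>Q = (1 - p) ^ card \<sigma>\<close>, and up to negligible errors this is the
  event that a copy of \<open>\<sigma>\<close> is visible in the trace. If \<open>y\<close> contains no copy of \<open>\<sigma>\<close>, this event is
  negligible for \<open>y\<close>; if \<open>y\<close> contains two copies, it has probability at least \<open>Q (1 + p)\<close>; and if
  there is just one copy, it places \<open>a\<close> at some \<open>b \<noteq> a\<close>, so that the mean position at which \<open>a\<close> is
  seen in the trace differs.
\<close>

subsection \<open>Recovery from pairwise tests\<close>

lemma map_pmf_mem_eq_bernoulli:
  "map_pmf (\<lambda>x. x \<in> A) M = bernoulli_pmf (measure_pmf.prob M A)"
proof (rule pmf_eqI)
  fix b :: bool
  have "measure_pmf.prob M {x. x \<notin> A} = 1 - measure_pmf.prob M A"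
    using measure_pmf.prob_compl[of A M] by (simp add: Compl_eq_Diff_UNIV[symmetric] Compl_eq)
  then show "pmf (map_pmf (\<lambda>x. x \<in> A) M) b = pmf (bernoulli_pmf (measure_pmf.prob M A)) b"
    by (cases b) (simp_all add: pmf_map vimage_def)
qed

lemma map_replicate_pmf: "replicate_pmf m (map_pmf f M) = map_pmf (map f) (replicate_pmf m M)"
  by (induction m) (simp_all add: map_pmf_def bind_assoc_pmf bind_return_pmf)

lemma map_pmf_hits_eq_binomial:
  "map_pmf (\<lambda>ts. length (filter (\<lambda>t. t \<in> A) ts)) (replicate_pmf m M)
     = binomial_pmf m (measure_pmf.prob M A)"
proof -
  have "binomial_pmf m (measure_pmf.prob M A)
      = map_pmf (length \<circ> filter id) (replicate_pmf m (map_pmf (\<lambda>x. x \<in> A) M))"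
    by (subst binomial_pmf_altdef) (simp_all add: map_pmf_mem_eq_bernoulli)
  also have "\<dots> = map_pmf (length \<circ> filter id) (map_pmf (map (\<lambda>x. x \<in> A)) (replicate_pmf m M))"
    by (simp add: map_replicate_pmf)
  also have "\<dots> = map_pmf (\<lambda>ts. length (filter (\<lambda>t. t \<in> A) ts)) (replicate_pmf m M)"
    by (simp add: map_pmf_comp o_def filter_map)
  finally show ?thesis ..
qed

definition freq :: "'a set \<Rightarrow> 'a list \<Rightarrow> real" where
  "freq A ts = real (length (filter (\<lambda>t. t \<in> A) ts)) / real (length ts)"

text \<open>Hoeffding's inequality, applied to the binomial number of hits of
  \<open>A\<close>.\<close>

lemma prob_freq_deviates:
  assumes "\<epsilon> \<ge> 0" "m > 0"
  shows "measure_pmf.prob (replicate_pmf m M) {ts. \<epsilon> \<le> \<bar>freq A ts - measure_pmf.prob M A\<bar>}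
     \<le> 2 * exp (- 2 * real m * \<epsilon>\<^sup>2)"
proof -
  let ?q = "measure_pmf.prob M A"
  \<comment> \<open>\<open>freq\<close> divides by the length of the list, which is \<open>m\<close>
    only on the support; hence an equality almost everywhere.\<close>
  have "measure_pmf.prob (replicate_pmf m M) {ts. \<epsilon> \<le> \<bar>freq A ts - ?q\<bar>}
      = measure_pmf.prob (replicate_pmf m M)
          ((\<lambda>ts. length (filter (\<lambda>t. t \<in> A) ts)) -` {c. \<epsilon> \<le> \<bar>real c / real m - ?q\<bar>})"
    by (intro measure_pmf.finite_measure_eq_AE)
       (auto simp: AE_measure_pmf_iff set_replicate_pmf freq_def)
  also have "\<dots> = measure_pmf.prob (binomial_pmf m ?q) {c. \<epsilon> \<le> \<bar>real c / real m - ?q\<bar>}"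
    by (simp flip: map_pmf_hits_eq_binomial)
  also have "\<dots> \<le> 2 * exp (- 2 * real m * \<epsilon>\<^sup>2)"
    using assms binomial_distribution.prob_abs_ge'[of ?q m \<epsilon>] by (simp add: binomial_distribution_def)
  finally show ?thesis .
qed

text \<open>Fix one test per pair and accept a candidate if its tests against all others have
  frequencies within \<open>\<epsilon> / 2\<close> of its own probabilities. Two accepted candidates
  would contradict the test between them, and the true one is rejected only if some frequency
  deviates, which Hoeffding and a union bound make unlikely.\<close>

lemma recovery_from_tests:
  fixes M :: "'b \<Rightarrow> 'a pmf"
  assumes fin: "finite X" and m: "m > 0" and eps: "\<epsilon> > 0"
    and test: "\<And>x y. x \<in> X \<Longrightarrow> y \<in> X \<Longrightarrow> x \<noteq> y \<Longrightarrow>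
      \<exists>A. \<epsilon> \<le> \<bar>measure_pmf.prob (M x) A - measure_pmf.prob (M y) A\<bar>"
  shows "\<exists>recover. \<forall>x\<in>X. measure_pmf.prob (replicate_pmf m (M x)) {ts. recover ts = x}
      \<ge> 1 - real (card X) * (2 * exp (- real m * \<epsilon>\<^sup>2 / 2))"
proof -
  let ?gap = "\<lambda>x y A. \<bar>measure_pmf.prob (M x) A - measure_pmf.prob (M y) A\<bar>"
  define T where "T x y = (SOME A. \<epsilon> \<le> ?gap x y A)" for x y
  have T: "\<epsilon> \<le> ?gap x y (T x y)" if "x \<in> X" "y \<in> X" "x \<noteq> y" for x y
    unfolding T_def using test[OF that] by (rule someI_ex)
  \<comment> \<open>Both orders of a pair must use the same test, so that one frequency is compared
    with both probabilities.\<close>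
  have T_sym: "T x y = T y x" for x y
    unfolding T_def by (subst abs_minus_commute) simp
  define ok where "ok ts x \<longleftrightarrow> x \<in> X \<and>
      (\<forall>y\<in>X - {x}. \<bar>freq (T x y) ts - measure_pmf.prob (M x) (T x y)\<bar> < \<epsilon> / 2)" for ts x
  have uniq: "x = y" if "ok ts x" "ok ts y" for ts x y
  proof (rule ccontr)
    assume ne: "x \<noteq> y"
    have "\<bar>freq (T x y) ts - measure_pmf.prob (M x) (T x y)\<bar> < \<epsilon> / 2"
      "\<bar>freq (T y x) ts - measure_pmf.prob (M y) (T y x)\<bar> < \<epsilon> / 2"
      using that ne unfolding ok_def by blast+
    moreover have "x \<in> X" "y \<in> X" using that by (auto simp: ok_def)
    then have "\<epsilon> \<le> ?gap y x (T y x)" using T ne by blast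
    ultimately show False unfolding T_sym[of x y] by linarith
  qed
  define recover where "recover ts = (THE x. ok ts x)" for ts
  have rec: "recover ts = x" if "ok ts x" for ts x
    unfolding recover_def using that uniq by blast
  have "measure_pmf.prob (replicate_pmf m (M x)) {ts. recover ts = x}
      \<ge> 1 - real (card X) * (2 * exp (- real m * \<epsilon>\<^sup>2 / 2))" if x: "x \<in> X" for x
  proof -
    let ?P = "measure_pmf.prob (replicate_pmf m (M x))"
    let ?bad = "\<lambda>y. {ts. \<epsilon> / 2 \<le> \<bar>freq (T x y) ts - measure_pmf.prob (M x) (T x y)\<bar>}"
    have "1 - ?P {ts. recover ts = x} = ?P (- {ts. recover ts = x})"
      using measure_pmf.prob_compl[of "{ts. recover ts = x}" "replicate_pmf m (M x)"]
      by (simp add: Compl_eq_Diff_UNIV)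
    also have "\<dots> \<le> ?P (\<Union>y\<in>X. ?bad y)"
      using rec x by (intro measure_pmf.finite_measure_mono) (auto simp: ok_def not_less[symmetric])
    also have "\<dots> \<le> (\<Sum>y\<in>X. ?P (?bad y))"
      using fin by (intro measure_pmf.finite_measure_subadditive_finite) auto
    also have "\<dots> \<le> (\<Sum>y\<in>X. 2 * exp (- 2 * real m * (\<epsilon> / 2)\<^sup>2))"
      using eps m by (intro sum_mono prob_freq_deviates) auto
    also have "\<dots> = real (card X) * (2 * exp (- real m * \<epsilon>\<^sup>2 / 2))"
      by (simp add: power_divide)
    finally show ?thesis by linarith
  qed
  then show ?thesis by blast
qed

subsection \<open>Rigid sets of ones\<close>

text \<open>\<open>linked A G i j\<close>: one can walk from \<open>i\<close> to \<open>j\<close> along \<open>A\<close> in steps shorter than \<open>G\<close>.\<close>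

definition linked :: "nat set \<Rightarrow> real \<Rightarrow> nat \<Rightarrow> nat \<Rightarrow> bool" where
  "linked A G i j \<longleftrightarrow>
     i \<le> j \<and> (\<forall>u\<in>A. i \<le> u \<and> u < j \<longrightarrow> (\<exists>v\<in>A. u < v \<and> v \<le> j \<and> real v - real u < G))"

section \<open>Clusters, the maximal chains with steps below a given scale, and their two
  ends\<close>

definition cluster_lo :: "nat set \<Rightarrow> real \<Rightarrow> nat \<Rightarrow> nat" where
  "cluster_lo A G s = Min {i \<in> A. linked A G i s}"

definition cluster_hi :: "nat set \<Rightarrow> real \<Rightarrow> nat \<Rightarrow> nat" where
  "cluster_hi A G s = Max {j \<in> A. linked A G s j}"

lemma linked_refl [simp]: "linked A G s s"
  by (auto simp: linked_def)

lemma linked_le: "linked A G i j \<Longrightarrow> i \<le> j"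
  by (simp add: linked_def)

lemma finite_linked_left: "finite {i \<in> A. linked A G i s}"
  by (rule finite_subset[of _ "{..s}"]) (auto simp: linked_def)

lemma lo_props:
  assumes "s \<in> A"
  shows "cluster_lo A G s \<in> A" "linked A G (cluster_lo A G s) s" "cluster_lo A G s \<le> s"
    and "\<And>i. i \<in> A \<Longrightarrow> linked A G i s \<Longrightarrow> cluster_lo A G s \<le> i"
proof -
  have "cluster_lo A G s \<in> {i \<in> A. linked A G i s}"
    unfolding cluster_lo_def using assms by (intro Min_in finite_linked_left) auto
  then show "cluster_lo A G s \<in> A" "linked A G (cluster_lo A G s) s" "cluster_lo A G s \<le> s"
    by (auto simp: linked_le)
  show "cluster_lo A G s \<le> i" if "i \<in> A" "linked A G i s" for i
    unfolding cluster_lo_def using that by (intro Min_le finite_linked_left) auto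
qed

lemma hi_props:
  assumes "finite A" "s \<in> A"
  shows "cluster_hi A G s \<in> A" "linked A G s (cluster_hi A G s)" "s \<le> cluster_hi A G s"
    and "\<And>j. j \<in> A \<Longrightarrow> linked A G s j \<Longrightarrow> j \<le> cluster_hi A G s"
proof -
  have "cluster_hi A G s \<in> {j \<in> A. linked A G s j}"
    unfolding cluster_hi_def using assms by (intro Max_in) auto
  then show "cluster_hi A G s \<in> A" "linked A G s (cluster_hi A G s)" "s \<le> cluster_hi A G s"
    by (auto simp: linked_le)
  show "j \<le> cluster_hi A G s" if "j \<in> A" "linked A G s j" for j
    unfolding cluster_hi_def using that assms by (intro Max_ge) auto
qed

lemma linked_trans:
  assumes "linked A G i s" "linked A G s j"
  shows "linked A G i j"
  unfolding linked_def
proof (intro conjI ballI impI)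
  show "i \<le> j" using assms linked_le by (meson order_trans)
  fix u assume u: "u \<in> A" "i \<le> u \<and> u < j"
  show "\<exists>v\<in>A. u < v \<and> v \<le> j \<and> real v - real u < G"
  proof (cases "u < s")
    case True
    then obtain v where "v \<in> A" "u < v" "v \<le> s" "real v - real u < G"
      using u assms(1) unfolding linked_def by blast
    then show ?thesis using linked_le[OF assms(2)] by (meson order_trans)
  next
    case False
    then show ?thesis using u assms(2) unfolding linked_def by (meson not_less)
  qed
qed

text \<open>Each step of a walk leaves a new point of \<open>A\<close> and covers less than
  \<open>G\<close>.\<close>

lemma linked_span:
  assumes "finite A" "linked A G i j" "i \<in> A"
  shows "real j - real i \<le> real (card {u \<in> A. i \<le> u \<and> u < j}) * G"
  using assms(2,3)
proof (induction "j - i" arbitrary: i rule: less_induct)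
  case less
  show ?case
  proof (cases "i = j")
    case False
    then have "i < j" using linked_le[OF less.prems(1)] by simp
    then obtain v where v: "v \<in> A" "i < v" "v \<le> j" "real v - real i < G"
      using less.prems unfolding linked_def by blast
    have "linked A G v j"
      using less.prems(1) v unfolding linked_def by (meson less_imp_le order_trans)
    then have IH: "real j - real v \<le> real (card {u \<in> A. v \<le> u \<and> u < j}) * G"
      using less.hyps[of v] v \<open>i < j\<close> by auto
    have "insert i {u \<in> A. v \<le> u \<and> u < j} \<subseteq> {u \<in> A. i \<le> u \<and> u < j}"
      using v less.prems \<open>i < j\<close> by auto
    then have "card (insert i {u \<in> A. v \<le> u \<and> u < j}) \<le> card {u \<in> A. i \<le> u \<and> u < j}"
      using assms(1) by (intro card_mono) auto
    moreover have "card (insert i {u \<in> A. v \<le> u \<and> u < j}) = Suc (card {u \<in> A. v \<le> u \<and> u < j})"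
      using assms(1) v by (subst card_insert_disjoint) auto
    ultimately have "real (card {u \<in> A. v \<le> u \<and> u < j}) + 1 \<le> real (card {u \<in> A. i \<le> u \<and> u < j})"
      by linarith
    moreover have "G > 0" using v by linarith
    ultimately have "(real (card {u \<in> A. v \<le> u \<and> u < j}) + 1) * G
        \<le> real (card {u \<in> A. i \<le> u \<and> u < j}) * G"
      by (intro mult_right_mono) auto
    then show ?thesis using IH v by (simp add: algebra_simps)
  qed (auto intro!: sum_nonneg simp: Collect_empty_eq[THEN iffD2])
qed

lemma cluster_span:
  assumes "finite A" "s \<in> A" "card A \<le> k" "G \<ge> 0"
  shows "real (cluster_hi A G s) - real (cluster_lo A G s) \<le> real k * G"
proof -
  have "linked A G (cluster_lo A G s) (cluster_hi A G s)"
    using assms lo_props hi_props by (meson linked_trans)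
  then have "real (cluster_hi A G s) - real (cluster_lo A G s)
      \<le> real (card {u \<in> A. cluster_lo A G s \<le> u \<and> u < cluster_hi A G s}) * G"
    by (intro linked_span) (use assms lo_props in auto)
  also have "card {u \<in> A. cluster_lo A G s \<le> u \<and> u < cluster_hi A G s} \<le> card A"
    using assms by (intro card_mono) auto
  then have "real (card {u \<in> A. cluster_lo A G s \<le> u \<and> u < cluster_hi A G s}) * G \<le> real k * G"
    using assms by (intro mult_right_mono) auto
  finally show ?thesis .
qed

text \<open>A point of \<open>A\<close> below the lower end but closer than \<open>G\<close> to it
  would extend the walk, against minimality.\<close>

lemma lo_isolated:
  assumes "s \<in> A" "w \<in> A" "cluster_lo A G s \<le> z" "real z - real w < G"
  shows "cluster_lo A G s \<le> w"
proof (rule ccontr)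
  let ?f = "cluster_lo A G s"
  assume "\<not> ?f \<le> w"
  then have w: "w < ?f" by simp
  have "linked A G w ?f"
    unfolding linked_def using w assms lo_props(1)[OF assms(1)]
    by (auto intro!: bexI[of _ ?f])
  then have "linked A G w s" using lo_props(2)[OF assms(1)] linked_trans by blast
  then have "?f \<le> w" using lo_props(4)[OF assms(1)] assms by blast
  with w show False by simp
qed

lemma hi_isolated:
  assumes "finite A" "s \<in> A" "w \<in> A" "z \<le> cluster_hi A G s" "real w - real z < G"
  shows "w \<le> cluster_hi A G s"
proof (rule ccontr)
  let ?e = "cluster_hi A G s"
  assume "\<not> w \<le> ?e"
  then have w: "?e < w" by simp
  have "linked A G ?e w"
    unfolding linked_def using w assms by (auto intro!: bexI[of _ w])
  then have "linked A G s w" using hi_props(2)[OF assms(1,2)] linked_trans by blast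
  then have "w \<le> ?e" using hi_props(4)[OF assms(1,2)] assms by blast
  with w show False by simp
qed

section \<open>Isolation, which characterises the ends of clusters\<close>

definition left_isolated :: "nat set \<Rightarrow> real \<Rightarrow> nat \<Rightarrow> bool" where
  "left_isolated A G s \<longleftrightarrow> (\<forall>w\<in>A. w < s \<longrightarrow> G \<le> real s - real w)"

definition right_isolated :: "nat set \<Rightarrow> real \<Rightarrow> nat \<Rightarrow> bool" where
  "right_isolated A G s \<longleftrightarrow> (\<forall>w\<in>A. s < w \<longrightarrow> G \<le> real w - real s)"

lemma left_isolated_lo: "s \<in> A \<Longrightarrow> left_isolated A G (cluster_lo A G s)"
  unfolding left_isolated_def using lo_isolated[of s A _ G "cluster_lo A G s"] by force

lemma right_isolated_hi: "finite A \<Longrightarrow> s \<in> A \<Longrightarrow> right_isolated A G (cluster_hi A G s)"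
  unfolding right_isolated_def using hi_isolated[of A s _ "cluster_hi A G s" G] by force

lemma lo_left_isolated:
  assumes "s \<in> A" "left_isolated A G s"
  shows "cluster_lo A G s = s"
proof (rule ccontr)
  assume "cluster_lo A G s \<noteq> s"
  \<comment> \<open>A walk to \<open>s\<close> from below must leave the largest point below
    \<open>s\<close>, and that step can only lead to \<open>s\<close> itself.\<close>
  define B where "B = {u \<in> A. u < s}"
  have "cluster_lo A G s \<in> B"
    using lo_props(1,3)[OF assms(1), of G] \<open>cluster_lo A G s \<noteq> s\<close> by (auto simp: B_def)
  have "finite B" by (auto simp: B_def)
  then have "Max B \<in> B" "cluster_lo A G s \<le> Max B" using \<open>cluster_lo A G s \<in> B\<close> by (auto intro: Max_in)
  then obtain v where v: "v \<in> A" "Max B < v" "v \<le> s" "real v - real (Max B) < G"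
    using lo_props(2)[OF assms(1), of G] unfolding linked_def B_def by blast
  then have "v \<notin> B" using \<open>finite B\<close> by (meson Max_ge not_less)
  then have "v = s" using v by (auto simp: B_def)
  then show False using assms(2) v \<open>Max B \<in> B\<close> unfolding left_isolated_def B_def by force
qed

lemma hi_right_isolated:
  assumes "finite A" "s \<in> A" "right_isolated A G s"
  shows "cluster_hi A G s = s"
proof (rule ccontr)
  assume "cluster_hi A G s \<noteq> s"
  then have "s < cluster_hi A G s" using hi_props(3)[OF assms(1,2), of G] by simp
  then obtain v where "v \<in> A" "s < v" "real v - real s < G"
    using hi_props(2)[OF assms(1,2), of G] assms(2) unfolding linked_def by blast
  then show False using assms(3) unfolding right_isolated_def by force
qed

text \<open>
  A cluster at scale \<open>G\<close> spans at most \<open>k G\<close>, so distances inside it are known up to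
  \<open>c * sqrt (k * G * l)\<close>, which is below the next smaller scale as long as that one is
  \<open>sqrt (G * g) / 2\<close>. Since the ratio to \<open>g\<close> is essentially squared from one scale to the next,
  \<open>log log n\<close> scales suffice.
\<close>

definition gap_scale :: "real \<Rightarrow> nat \<Rightarrow> real" where
  "gap_scale g j = g / 4 * 2 ^ (2 ^ j)"

lemma gap_scale_sq: "(gap_scale g j)\<^sup>2 = g / 4 * gap_scale g (Suc j)"
  by (simp add: gap_scale_def power2_eq_square flip: power_add mult_2)

lemma gap_scale_mono: "g \<ge> 0 \<Longrightarrow> i \<le> j \<Longrightarrow> gap_scale g i \<le> gap_scale g j"
  by (auto simp: gap_scale_def intro!: mult_left_mono power_increasing)

text \<open>
  The ends of the cluster of \<open>s\<close> can only move inwards, and their distance is almost preserved, so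
  they pin down \<open>s\<close> within the next smaller scale; the ends have to be pinned down recursively.
\<close>

primrec anchors :: "nat set \<Rightarrow> real \<Rightarrow> nat \<Rightarrow> nat \<Rightarrow> nat set" where
  "anchors A g 0 s = {s}"
| "anchors A g (Suc j) s = anchors A g j s \<union> anchors A g j (cluster_lo A (gap_scale g (Suc j)) s)
     \<union> anchors A g j (cluster_hi A (gap_scale g (Suc j)) s)"

lemma anchors_self: "s \<in> anchors A g j s"
  by (induction j) auto

lemma anchors_subset: "finite A \<Longrightarrow> s \<in> A \<Longrightarrow> anchors A g j s \<subseteq> A"
  by (induction j arbitrary: s) (simp_all add: lo_props(1) hi_props(1))

text \<open>
  An end of a cluster is an end of its smaller clusters, too. Hence the recursion only branches
  twice, which gives \<open>2 ^ j = O(log n)\<close> anchors; a threefold branching would not be affordable.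
\<close>

lemma card_anchors_isolated:
  assumes "finite A" "g \<ge> 0" "s \<in> A" "left_isolated A (gap_scale g j) s \<or> right_isolated A (gap_scale g j) s"
  shows "card (anchors A g j s) \<le> 2 ^ j"
  using assms(3,4)
proof (induction j arbitrary: s)
  case (Suc j)
  let ?G = "gap_scale g (Suc j)" and ?H = "gap_scale g j"
  have "?H \<le> ?G" using gap_scale_mono[OF assms(2), of j "Suc j"] by simp
  then have L: "left_isolated A ?G w \<Longrightarrow> left_isolated A ?H w"
    and R: "right_isolated A ?G w \<Longrightarrow> right_isolated A ?H w" for w
    unfolding left_isolated_def right_isolated_def by force+
  have cluster_lo: "card (anchors A g j (cluster_lo A ?G s)) \<le> 2 ^ j"
    using Suc.prems L left_isolated_lo lo_props(1) by (intro Suc.IH) auto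
  have cluster_hi: "card (anchors A g j (cluster_hi A ?G s)) \<le> 2 ^ j"
    using Suc.prems R right_isolated_hi hi_props(1) assms(1) by (intro Suc.IH) auto
  have "cluster_lo A ?G s = s \<or> cluster_hi A ?G s = s"
    using Suc.prems lo_left_isolated hi_right_isolated assms(1) by blast
  then have "anchors A g (Suc j) s = anchors A g j (cluster_lo A ?G s) \<union> anchors A g j (cluster_hi A ?G s)"
    by auto
  then show ?case
    using card_Un_le[of "anchors A g j (cluster_lo A ?G s)" "anchors A g j (cluster_hi A ?G s)"] cluster_lo cluster_hi by simp
qed simp

text \<open>The branches at the two ends start from isolated points and contribute
  \<open>2 ^ j\<close> each; only the branch that stays at \<open>s\<close> needs the induction
  hypothesis, so each scale at most doubles the bound.\<close>

lemma card_anchors: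
  assumes "finite A" "g \<ge> 0" "s \<in> A"
  shows "card (anchors A g j s) \<le> 2 ^ Suc j"
proof (induction j)
  case (Suc j)
  let ?G = "gap_scale g (Suc j)" and ?H = "gap_scale g j"
  have "?H \<le> ?G" using gap_scale_mono[OF assms(2), of j "Suc j"] by simp
  then have L: "left_isolated A ?G w \<Longrightarrow> left_isolated A ?H w"
    and R: "right_isolated A ?G w \<Longrightarrow> right_isolated A ?H w" for w
    unfolding left_isolated_def right_isolated_def by force+
  have cluster_lo: "card (anchors A g j (cluster_lo A ?G s)) \<le> 2 ^ j"
    using assms L left_isolated_lo lo_props(1) by (intro card_anchors_isolated) auto
  have cluster_hi: "card (anchors A g j (cluster_hi A ?G s)) \<le> 2 ^ j"
    using assms R right_isolated_hi hi_props(1) by (intro card_anchors_isolated) auto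
  have "card (anchors A g (Suc j) s) \<le> card (anchors A g j s) + card (anchors A g j (cluster_lo A ?G s))
      + card (anchors A g j (cluster_hi A ?G s))"
    by simp (meson add_mono card_Un_le le_refl order_trans)
  then show ?case using Suc.IH cluster_lo cluster_hi by simp
qed simp

text \<open>An approximate copy of \<open>\<sigma>\<close> in \<open>A\<close>: a distance may be
  off by the order of the fluctuation that random deletions cause on a stretch of that length.
  Values of \<open>\<phi>\<close> off \<open>\<sigma>\<close> are irrelevant.\<close>

definition near :: "real \<Rightarrow> real \<Rightarrow> nat set \<Rightarrow> nat set \<Rightarrow> (nat \<Rightarrow> nat) \<Rightarrow> bool" where
  "near l c \<sigma> A \<phi> \<longleftrightarrow> \<phi> ` \<sigma> \<subseteq> A \<and> strict_mono_on \<sigma> \<phi> \<and>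
     (\<forall>s\<in>\<sigma>. \<forall>s'\<in>\<sigma>. s < s' \<longrightarrow>
        \<bar>(real (\<phi> s') - real (\<phi> s)) - (real s' - real s)\<bar> \<le> c * sqrt ((real s' - real s) * l))"

lemma near_subset: "near l c \<sigma> A \<phi> \<Longrightarrow> \<tau> \<subseteq> \<sigma> \<Longrightarrow> near l c \<tau> A \<phi>"
  unfolding near_def strict_mono_on_def by (meson image_mono order_trans subsetD)

lemma near_le:
  assumes "near l c \<sigma> A \<phi>" "s \<in> \<sigma>" "s' \<in> \<sigma>" "s \<le> s'" "real s' - real s \<le> d" "c \<ge> 0" "l \<ge> 0"
  shows "\<bar>(real (\<phi> s') - real (\<phi> s)) - (real s' - real s)\<bar> \<le> c * sqrt (d * l)"
proof (cases "s = s'")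
  case True
  then show ?thesis using assms by simp
next
  case False
  then have "\<bar>(real (\<phi> s') - real (\<phi> s)) - (real s' - real s)\<bar> \<le> c * sqrt ((real s' - real s) * l)"
    using assms by (auto simp: near_def)
  also have "\<dots> \<le> c * sqrt (d * l)"
    using assms by (intro mult_left_mono) (auto intro!: mult_right_mono)
  finally show ?thesis .
qed

text \<open>Induction on the scale: a displacement of \<open>s\<close> below half of one scale is
  improved to one below half of the next smaller scale, both for \<open>s\<close> and for the ends
  of its cluster. At the smallest scale the displacement is below \<open>g\<close>, so the gap
  condition makes it zero.\<close>

lemma anchors_rigid:
  assumes A: "finite A" "card A \<le> k"
    and gap: "\<And>i j. i \<in> A \<Longrightarrow> j \<in> A \<Longrightarrow> i < j \<Longrightarrow> g \<le> real j - real i"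
    and g: "100 * c\<^sup>2 * real k * l \<le> g" "g > 0" and cl: "c \<ge> 0" "l \<ge> 0"
    and s: "s \<in> A" and near: "near l c (anchors A g j s) A \<phi>"
    and close: "\<bar>real (\<phi> s) - real s\<bar> < gap_scale g j / 2"
  shows "\<forall>z\<in>anchors A g j s. \<phi> z = z"
  using s near close
proof (induction j arbitrary: s)
  case 0
  have "\<phi> s \<in> A" using 0 by (auto simp: near_def)
  moreover have "\<bar>real (\<phi> s) - real s\<bar> < g" using 0 g by (simp add: gap_scale_def)
  ultimately have "\<phi> s = s"
    using gap[of s "\<phi> s"] gap[of "\<phi> s" s] 0 by (cases "\<phi> s" s rule: linorder_cases) auto
  then show ?case by simp
next
  case (Suc j)
  \<comment> \<open>\<open>\<tau>\<close> bounds every distance error inside the cluster, whose span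
    is at most \<open>k * G\<close>.\<close>
  define G H \<tau> where "G = gap_scale g (Suc j)" and "H = gap_scale g j" and "\<tau> = c * sqrt (real k * G * l)"
  define f e where "f = cluster_lo A G s" and "e = cluster_hi A G s"
  have G: "G > 0" "H > 0" "H \<le> G" "g / 2 \<le> H"
    using g gap_scale_mono[of g j "Suc j"] gap_scale_mono[of g 0 j] by (auto simp: G_def H_def gap_scale_def)
  have \<tau>0: "\<tau> \<ge> 0" using cl G by (simp add: \<tau>_def)
  \<comment> \<open>Here the factor 100 enters: \<open>25 * c\<^sup>2 * k * l\<close> is at most
    \<open>g / 4\<close>, and \<open>g / 4 * G\<close> is the square of \<open>H\<close>.\<close>
  have sq: "(5 * \<tau>)\<^sup>2 \<le> H\<^sup>2"
  proof -
    have "(5 * \<tau>)\<^sup>2 = 25 * c\<^sup>2 * real k * l * G"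
      using G cl by (simp add: \<tau>_def power_mult_distrib)
    also have "\<dots> \<le> g / 4 * G" using g G by (intro mult_right_mono) auto
    also have "\<dots> = H\<^sup>2" by (simp add: H_def G_def gap_scale_sq)
    finally show ?thesis .
  qed
  then have \<tau>H: "5 * \<tau> \<le> H" using G by (meson less_imp_le power2_le_imp_le)
  have f: "f \<in> A" "f \<le> s" and e: "e \<in> A" "s \<le> e"
    using Suc.prems A lo_props hi_props by (auto simp: f_def e_def)
  have span: "real e - real f \<le> real k * G"
    unfolding e_def f_def using A Suc.prems G by (intro cluster_span) auto
  let ?B = "anchors A g (Suc j) s"
  have mem: "f \<in> ?B" "e \<in> ?B" "s \<in> ?B"
    using anchors_self by (auto simp: f_def e_def G_def)
  have N: "\<bar>(real (\<phi> v) - real (\<phi> u)) - (real v - real u)\<bar> \<le> \<tau>"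
    if "u \<in> ?B" "v \<in> ?B" "f \<le> u" "u \<le> v" "v \<le> e" for u v
    unfolding \<tau>_def using that span cl
    by (intro near_le[OF Suc.prems(2)]) auto
  have "\<bar>real (\<phi> s) - real s\<bar> < G / 2" using Suc.prems by (simp add: G_def)
  \<comment> \<open>The ends move by less than \<open>G / 2 + \<tau>\<close>, and
    \<open>\<tau>\<close> is at most \<open>H / 5\<close>.\<close>
  have "\<bar>real (\<phi> f) - real f\<bar> < G" "\<bar>real (\<phi> e) - real e\<bar> < G"
    using N[of f s] N[of s e] mem f e \<open>\<bar>real (\<phi> s) - real s\<bar> < G / 2\<close> \<tau>H G by linarith+
  moreover have "\<phi> f \<in> A" "\<phi> e \<in> A" using Suc.prems(2) mem by (auto simp: near_def)
  \<comment> \<open>Images of the ends are points of \<open>A\<close> within \<open>G\<close> of the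
    ends, so isolation lets them move only inwards.\<close>
  ultimately have "f \<le> \<phi> f" "\<phi> e \<le> e"
    using lo_isolated[OF Suc.prems(1), of "\<phi> f" G f] hi_isolated[OF A(1) Suc.prems(1), of "\<phi> e" e G]
    by (auto simp: f_def e_def)
  \<comment> \<open>The two inward displacements add up to the loss of distance between the ends,
    which is at most \<open>\<tau>\<close>.\<close>
  then have fe: "\<bar>real (\<phi> f) - real f\<bar> \<le> \<tau>" "\<bar>real (\<phi> e) - real e\<bar> \<le> \<tau>"
    using N[of f e] mem f e by linarith+
  have *: "\<bar>real (\<phi> s) - real s\<bar> \<le> 2 * \<tau>"
    using N[of f s] mem f e fe by linarith
  have "\<bar>real (\<phi> u) - real u\<bar> < gap_scale g j / 2" if "u \<in> {s,f,e}" for u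
    using that fe * \<tau>H \<tau>0 G by (auto simp: H_def)
  then show ?case
    using Suc.IH[of s] Suc.IH[of f] Suc.IH[of e] near_subset[OF Suc.prems(2)] f e Suc.prems(1)
    by (auto simp: f_def e_def G_def)
qed

subsection \<open>Copies in a string and in its trace\<close>

text \<open>For a surviving index this is its position in the trace.\<close>

definition rank :: "(nat \<Rightarrow> bool) \<Rightarrow> nat \<Rightarrow> nat" where
  "rank keep i = card {l. l < i \<and> keep l}"

lemma rank_less: "keep i \<Longrightarrow> i < j \<Longrightarrow> rank keep i < rank keep j"
  unfolding rank_def by (intro psubset_card_mono) auto

lemma rank_diff:
  assumes "i \<le> j"
  shows "real (rank keep j) - real (rank keep i) = real (card {l \<in> {i..<j}. keep l})"
proof -
  have eq: "{l. l < j \<and> keep l} = {l. l < i \<and> keep l} \<union> {l \<in> {i..<j}. keep l}"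
    using assms by auto
  have "rank keep j = rank keep i + card {l \<in> {i..<j}. keep l}"
    unfolding rank_def eq by (rule card_Un_disjoint) auto
  then show ?thesis by simp
qed

lemma length_nths_rank: "length (nths x {i. keep i}) = rank keep (length x)"
  by (simp add: length_nths rank_def)

lemma nths_rank:
  assumes "i < length x" "keep i"
  shows "rank keep i < length (nths x {i. keep i})" "nths x {i. keep i} ! rank keep i = x ! i"
proof -
  let ?K = "{i. keep i}"
  have x: "x = take i x @ x ! i # drop (Suc i) x" using assms(1) by (rule id_take_nth_drop)
  have "nths x ?K = nths (take i x) ?K @ x ! i # nths (drop (Suc i) x) {j. keep (Suc j + i)}"
    using assms by (subst x) (simp add: nths_append nths_Cons del: append_take_drop_id)
  moreover have "length (nths (take i x) ?K) = rank keep i"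
    using assms by (simp add: length_nths_rank)
  ultimately show "rank keep i < length (nths x ?K)" "nths x ?K ! rank keep i = x ! i"
    by (simp_all add: nth_append)
qed

text \<open>\<open>rank keep\<close> is injective on the surviving indices and maps them into
  equally many trace positions, hence onto.\<close>

lemma rank_surj:
  assumes "u < length (nths x {i. keep i})"
  obtains i where "i < length x" "keep i" "u = rank keep i"
proof -
  let ?S = "{i. i < length x \<and> keep i}"
  have "rank keep ` ?S \<subseteq> {..<card ?S}"
    using nths_rank(1)[of _ x keep] by (auto simp: length_nths)
  moreover have "inj_on (rank keep) ?S"
    using rank_less[of keep] by (intro linorder_inj_onI') force
  then have "card (rank keep ` ?S) = card {..<card ?S}" by (simp add: card_image)
  ultimately have "rank keep ` ?S = {..<card ?S}" by (intro card_subset_eq) auto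
  then show thesis using assms that by (auto simp: length_nths image_iff set_eq_iff)
qed

text \<open>In \<open>balanced\<close>, \<open>near\<close> and \<open>valid\<close>, the parameter \<open>l\<close> stands for \<open>ln n\<close> and \<open>q\<close> for the
  survival probability.\<close>

definition balanced :: "real \<Rightarrow> real \<Rightarrow> real \<Rightarrow> nat \<Rightarrow> (nat \<Rightarrow> bool) \<Rightarrow> bool" where
  "balanced q l \<mu> n keep \<longleftrightarrow> (\<forall>i j. i < j \<and> j \<le> n \<longrightarrow>
     \<bar>(real (rank keep j) - real (rank keep i)) - q * (real j - real i)\<bar> \<le> \<mu> * sqrt ((real j - real i) * l))"

text \<open>The counterpart of \<open>near\<close> in a trace, with distances shrunk by the factor
  \<open>q\<close>. It refers to the trace alone, so it can be tested without knowing the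
  deletions.\<close>

definition valid :: "real \<Rightarrow> real \<Rightarrow> real \<Rightarrow> nat set \<Rightarrow> bool list \<Rightarrow> (nat \<Rightarrow> nat) \<Rightarrow> bool" where
  "valid q l c \<sigma> t \<psi> \<longleftrightarrow> \<psi> ` \<sigma> \<subseteq> ones t \<and> strict_mono_on \<sigma> \<psi> \<and>
     (\<forall>s\<in>\<sigma>. \<forall>s'\<in>\<sigma>. s < s' \<longrightarrow>
        \<bar>(real (\<psi> s') - real (\<psi> s)) - q * (real s' - real s)\<bar> \<le> c * sqrt ((real s' - real s) * l))"

lemma sqrt_le_of_sq: "0 \<le> b \<Longrightarrow> a \<le> b\<^sup>2 \<Longrightarrow> sqrt a \<le> b"
  by (metis real_sqrt_le_iff real_sqrt_abs abs_of_nonneg)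

text \<open>The error of the copy is scaled by \<open>q\<close>, and balance adds
  \<open>\<mu> * sqrt (d' * l)\<close> for a distance \<open>d'\<close> in the copy. The gap
  hypothesis keeps \<open>d'\<close> within a constant factor of the original distance
  \<open>d\<close>, which costs the factor 2 before \<open>\<mu>\<close>.\<close>

lemma near_imp_valid:
  fixes y :: "bool list"
  assumes q: "0 < q" "q \<le> 1" and l: "0 \<le> l" and \<mu>: "\<mu> \<ge> 0" and c: "0 \<le> c"
    and gap: "\<And>s s'. s \<in> \<sigma> \<Longrightarrow> s' \<in> \<sigma> \<Longrightarrow> s < s' \<Longrightarrow> c\<^sup>2 * l \<le> real s' - real s"
    and near: "near l c \<sigma> (ones y) \<phi>"
    and kept: "\<And>s. s \<in> \<sigma> \<Longrightarrow> keep (\<phi> s)"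
    and bal: "balanced q l \<mu> (length y) keep"
  shows "valid q l (2 * \<mu> + q * c) \<sigma> (nths y {i. keep i}) (rank keep \<circ> \<phi>)"
proof -
  have ones: "\<phi> s \<in> ones y" if "s \<in> \<sigma>" for s using near that by (auto simp: near_def)
  have mono: "\<phi> s < \<phi> s'" if "s \<in> \<sigma>" "s' \<in> \<sigma>" "s < s'" for s s'
    using near that by (auto simp: near_def strict_mono_on_def)
  show ?thesis unfolding valid_def
  proof (intro conjI ballI impI)
    show "(rank keep \<circ> \<phi>) ` \<sigma> \<subseteq> ones (nths y {i. keep i})"
      using ones kept nths_rank[of _ y keep] by (auto simp: ones_def)
    show "strict_mono_on \<sigma> (rank keep \<circ> \<phi>)"
      using kept mono by (auto simp: strict_mono_on_def rank_less)
    fix s s' assume s: "s \<in> \<sigma>" "s' \<in> \<sigma>" "s < s'"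
    define d d' where "d = real s' - real s" and "d' = real (\<phi> s') - real (\<phi> s)"
    have d: "d > 0" "c\<^sup>2 * l \<le> d" using s gap by (auto simp: d_def)
    have 1: "\<bar>d' - d\<bar> \<le> c * sqrt (d * l)"
      using near s unfolding near_def d_def d'_def by blast
    also have "c * sqrt (d * l) = sqrt (c\<^sup>2 * l * d)"
      using c by (simp add: real_sqrt_mult mult.commute mult.left_commute)
    also have "\<dots> \<le> d" using d by (intro sqrt_le_of_sq) (auto simp: power2_eq_square)
    finally have "d' \<le> 2\<^sup>2 * d" using d by simp
    then have "sqrt (d' * l) \<le> sqrt (2\<^sup>2 * (d * l))"
      using l mult_right_mono[of d' "4 * d" l] by simp
    also have "\<dots> = 2 * sqrt (d * l)" by (simp add: real_sqrt_mult)
    finally have 2: "\<mu> * sqrt (d' * l) \<le> 2 * \<mu> * sqrt (d * l)"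
      using \<mu> mult_left_mono by fastforce
    have "\<phi> s < \<phi> s'" "\<phi> s' \<le> length y" using mono[OF s] ones[OF s(2)] by (auto simp: ones_def)
    then have 3: "\<bar>(real (rank keep (\<phi> s')) - real (rank keep (\<phi> s))) - q * d'\<bar> \<le> \<mu> * sqrt (d' * l)"
      using bal unfolding balanced_def d'_def by blast
    have "\<bar>q * d' - q * d\<bar> \<le> q * (c * sqrt (d * l))"
      using mult_left_mono[OF 1, of q] q by (simp add: abs_mult flip: right_diff_distrib)
    then have "\<bar>(real (rank keep (\<phi> s')) - real (rank keep (\<phi> s))) - q * d\<bar>
        \<le> 2 * \<mu> * sqrt (d * l) + q * (c * sqrt (d * l))"
      using 2 3 by linarith
    then show "\<bar>(real ((rank keep \<circ> \<phi>) s') - real ((rank keep \<circ> \<phi>) s)) - q * (real s' - real s)\<bar>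
        \<le> (2 * \<mu> + q * c) * sqrt ((real s' - real s) * l)"
      unfolding d_def by (simp add: algebra_simps)
  qed
qed

text \<open>Every visible position comes from a surviving index; undoing the shrinking divides the
  errors by \<open>q\<close>.\<close>

lemma valid_imp_near:
  fixes y :: "bool list"
  assumes q: "0 < q" "q \<le> 1" and l: "0 \<le> l" and \<mu>: "\<mu> \<ge> 0" and c: "0 \<le> c"
    and gap: "\<And>s s'. s \<in> \<sigma> \<Longrightarrow> s' \<in> \<sigma> \<Longrightarrow> s < s' \<Longrightarrow> ((c + 2 * \<mu>) / q)\<^sup>2 * l \<le> real s' - real s"
    and valid: "valid q l c \<sigma> (nths y {i. keep i}) \<psi>"
    and bal: "balanced q l \<mu> (length y) keep"
  obtains \<phi> where "near l ((c + 2 * \<mu>) / q) \<sigma> (ones y) \<phi>"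
    "\<And>s. s \<in> \<sigma> \<Longrightarrow> keep (\<phi> s)" "\<And>s. s \<in> \<sigma> \<Longrightarrow> \<psi> s = rank keep (\<phi> s)"
proof -
  have "\<exists>i. i < length y \<and> keep i \<and> \<psi> s = rank keep i" if "s \<in> \<sigma>" for s
  proof -
    have "\<psi> s < length (nths y {i. keep i})" using valid that by (auto simp: valid_def ones_def)
    then show ?thesis by (rule rank_surj) blast
  qed
  then obtain \<phi> where \<phi>: "\<And>s. s \<in> \<sigma> \<Longrightarrow> \<phi> s < length y \<and> keep (\<phi> s) \<and> \<psi> s = rank keep (\<phi> s)"
    by atomize_elim (rule choice, blast)
  have ones: "\<phi> s \<in> ones y" if "s \<in> \<sigma>" for s
    using valid that \<phi>[OF that] nths_rank[of "\<phi> s" y keep] by (auto simp: valid_def ones_def)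
  have mono: "\<phi> s < \<phi> s'" if "s \<in> \<sigma>" "s' \<in> \<sigma>" "s < s'" for s s'
  proof (rule ccontr)
    assume "\<not> \<phi> s < \<phi> s'"
    then have "\<psi> s' \<le> \<psi> s"
      using \<phi>[OF that(1)] \<phi>[OF that(2)] rank_less[of keep "\<phi> s'" "\<phi> s"] by (cases "\<phi> s = \<phi> s'") auto
    moreover have "\<psi> s < \<psi> s'" using valid that by (auto simp: valid_def strict_mono_on_def)
    ultimately show False by simp
  qed
  have "near l ((c + 2 * \<mu>) / q) \<sigma> (ones y) \<phi>" unfolding near_def
  proof (intro conjI ballI impI)
    show "\<phi> ` \<sigma> \<subseteq> ones y" using ones by blast
    show "strict_mono_on \<sigma> \<phi>" using mono by (auto simp: strict_mono_on_def)
    fix s s' assume s: "s \<in> \<sigma>" "s' \<in> \<sigma>" "s < s'"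
    define d d' where "d = real s' - real s" and "d' = real (\<phi> s') - real (\<phi> s)"
    have d: "d > 0" "((c + 2 * \<mu>) / q)\<^sup>2 * l \<le> d" using s gap by (auto simp: d_def)
    have d': "d' > 0" using mono[OF s] by (simp add: d'_def)
    have 1: "\<bar>(real (\<psi> s') - real (\<psi> s)) - q * d\<bar> \<le> c * sqrt (d * l)"
      using valid s unfolding valid_def d_def by blast
    have "\<phi> s < \<phi> s'" "\<phi> s' \<le> length y" using mono[OF s] ones[OF s(2)] by (auto simp: ones_def)
    then have 2: "\<bar>(real (\<psi> s') - real (\<psi> s)) - q * d'\<bar> \<le> \<mu> * sqrt (d' * l)"
      using bal \<phi>[OF s(1)] \<phi>[OF s(2)] unfolding balanced_def d'_def by simp
    have 3: "\<bar>q * (d' - d)\<bar> \<le> c * sqrt (d * l) + \<mu> * sqrt (d' * l)"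
      using 1 2 by (simp add: right_diff_distrib)
    \<comment> \<open>The error in 3 involves the unknown \<open>d'\<close> itself. If
      \<open>d'\<close> exceeded \<open>4 * d\<close>, the left side would exceed
      \<open>3 / 4 * q * d'\<close>, while the gap hypothesis bounds the right side by
      \<open>q * d' / 2\<close>.\<close>
    have "d' \<le> 4 * d"
    proof (rule ccontr)
      assume "\<not> d' \<le> 4 * d"
      then have big: "4 * d < d'" by simp
      have "sqrt (d * l) \<le> sqrt (d' * l / 4)"
        using big l mult_right_mono[of "4 * d" d' l] by (intro real_sqrt_le_mono) simp
      also have "\<dots> = sqrt (d' * l) / 2" by (simp add: real_sqrt_divide)
      finally have "c * sqrt (d * l) \<le> c * (sqrt (d' * l) / 2)" using c by (rule mult_left_mono)
      moreover have "q * (3 / 4 * d') < q * (d' - d)" using big q by (intro mult_strict_left_mono) auto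
      ultimately have "q * (3 / 4 * d') < (c + 2 * \<mu>) * sqrt (d' * l) / 2"
        using 3 by (simp add: algebra_simps)
      then have "3 / 2 * d' < (c + 2 * \<mu>) / q * sqrt (d' * l)"
        using q by (simp add: field_simps)
      also have "\<dots> = sqrt (((c + 2 * \<mu>) / q)\<^sup>2 * l * d')"
        using c \<mu> q by (simp add: real_sqrt_mult mult.commute mult.left_commute)
      also have "\<dots> \<le> d'"
      proof (rule sqrt_le_of_sq)
        have "((c + 2 * \<mu>) / q)\<^sup>2 * l \<le> d'" using d big by linarith
        then show "((c + 2 * \<mu>) / q)\<^sup>2 * l * d' \<le> d'\<^sup>2"
          unfolding power2_eq_square[of d'] using d' by (intro mult_right_mono) auto
      qed (use d' in simp)
      finally show False using d' by simp
    qed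
    then have "sqrt (d' * l) \<le> sqrt (2\<^sup>2 * (d * l))"
      using l mult_right_mono[of d' "4 * d" l] by simp
    also have "\<dots> = 2 * sqrt (d * l)" by (simp add: real_sqrt_mult)
    finally have "\<mu> * sqrt (d' * l) \<le> 2 * \<mu> * sqrt (d * l)"
      using \<mu> mult_left_mono by fastforce
    moreover have "q * \<bar>d' - d\<bar> \<le> c * sqrt (d * l) + \<mu> * sqrt (d' * l)"
      using 3 q by (simp add: abs_mult)
    ultimately have "q * \<bar>d' - d\<bar> \<le> (c + 2 * \<mu>) * sqrt (d * l)"
      unfolding distrib_right by linarith
    then have "\<bar>d' - d\<bar> \<le> (c + 2 * \<mu>) / q * sqrt (d * l)"
      using q by (simp add: field_simps)
    then show "\<bar>(real (\<phi> s') - real (\<phi> s)) - (real s' - real s)\<bar>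
        \<le> (c + 2 * \<mu>) / q * sqrt ((real s' - real s) * l)"
      unfolding d_def d'_def .
  qed
  then show thesis using that \<phi> by blast
qed

subsection \<open>Random deletions\<close>

abbreviation keep_pmf :: "real \<Rightarrow> nat \<Rightarrow> (nat \<Rightarrow> bool) pmf" where
  "keep_pmf q n \<equiv> Pi_pmf {..<n} False (\<lambda>_. bernoulli_pmf q)"

definition all_kept :: "nat set \<Rightarrow> (nat \<Rightarrow> bool) set" where
  "all_kept S = {keep. \<forall>s\<in>S. keep s}"

lemma prob_all_kept:
  assumes "0 \<le> q" "q \<le> 1" "S \<subseteq> {..<n}"
  shows "measure_pmf.prob (keep_pmf q n) (all_kept S) = q ^ card S"
proof -
  let ?B = "\<lambda>i. if i \<in> S then {True} else UNIV"
  have "all_kept S = Pi {..<n} ?B"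
    using assms(3) by (auto simp: all_kept_def Pi_def)
  then have "measure_pmf.prob (keep_pmf q n) (all_kept S)
      = (\<Prod>i<n. measure_pmf.prob (bernoulli_pmf q) (?B i))"
    by (simp add: measure_Pi_pmf_Pi)
  also have "\<dots> = (\<Prod>i<n. if i \<in> S then q else 1)"
    using assms by (intro prod.cong) (auto simp: measure_pmf_single)
  also have "\<dots> = q ^ card ({..<n} \<inter> S)" by (simp add: prod.If_cases)
  also have "\<dots> = q ^ card S" using assms(3) by (simp add: Int_absorb1)
  finally show ?thesis .
qed

lemma sum_prob_eq_expectation:
  assumes "finite I"
  shows "(\<Sum>i\<in>I. measure_pmf.prob M (A i))
     = measure_pmf.expectation M (\<lambda>\<omega>. real (card {i \<in> I. \<omega> \<in> A i}))"
proof -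
  have "(\<Sum>i\<in>I. measure_pmf.prob M (A i)) = (\<Sum>i\<in>I. measure_pmf.expectation M (indicator (A i)))"
    by simp
  also have "\<dots> = measure_pmf.expectation M (\<lambda>\<omega>. \<Sum>i\<in>I. indicator (A i) \<omega>)"
    by (intro Bochner_Integration.integral_sum[symmetric]) (auto intro!: measure_pmf.integrable_const_bound[of _ 1])
  also have "\<dots> = measure_pmf.expectation M (\<lambda>\<omega>. real (card {i \<in> I. \<omega> \<in> A i}))"
    using assms by (intro Bochner_Integration.integral_cong refl)
      (simp add: indicator_def sum.If_cases Int_def)
  finally show ?thesis .
qed

text \<open>By the tail-sum formula this is the mean of \<open>rank keep b\<close> on the event that
  \<open>S\<close> survives. There the \<open>r\<close> elements of \<open>S\<close> below
  \<open>b\<close> count fully, and each of the other \<open>b - r\<close> indices with weight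
  \<open>q\<close>.\<close>

lemma sum_prob_rank:
  assumes q: "0 \<le> q" "q \<le> 1" and S: "S \<subseteq> {..<n}" "b \<le> n"
  defines "r \<equiv> card (S \<inter> {..<b})"
  shows "(\<Sum>j<n. measure_pmf.prob (keep_pmf q n) (all_kept S \<inter> {keep. j < rank keep b}))
     = q ^ card S * (real r + q * (real b - real r))"
proof -
  let ?P = "measure_pmf.prob (keep_pmf q n)"
  have fS: "finite S" using S finite_subset by blast
  have rank_le: "rank keep b \<le> n" for keep
  proof -
    have "rank keep b \<le> card {..<b}" unfolding rank_def by (intro card_mono) auto
    then show ?thesis using S(2) by simp
  qed
  \<comment> \<open>Both sums are the expected number of survivors below \<open>b\<close> on
    \<open>all_kept S\<close>: once counted by trace positions, once by indices.\<close>
  have "(\<Sum>j<n. ?P (all_kept S \<inter> {keep. j < rank keep b})) = (\<Sum>i<b. ?P (all_kept (insert i S)))"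
  proof -
    have "card {j \<in> {..<n}. keep \<in> all_kept S \<inter> {keep. j < rank keep b}}
        = card {i \<in> {..<b}. keep \<in> all_kept (insert i S)}" for keep
    proof -
      have "{j \<in> {..<n}. keep \<in> all_kept S \<inter> {keep. j < rank keep b}}
          = (if keep \<in> all_kept S then {..<rank keep b} else {})"
        using rank_le[of keep] by auto
      moreover have "{i \<in> {..<b}. keep \<in> all_kept (insert i S)}
          = (if keep \<in> all_kept S then {l. l < b \<and> keep l} else {})"
        by (auto simp: all_kept_def)
      ultimately show ?thesis by (simp add: rank_def)
    qed
    then show ?thesis by (simp only: sum_prob_eq_expectation finite_lessThan)
  qed
  also have "\<dots> = (\<Sum>i<b. if i \<in> S then q ^ card S else q ^ card S * q)"
    using S fS q by (intro sum.cong refl) (subst prob_all_kept, auto simp: insert_absorb)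
  also have "\<dots> = real (card ({..<b} \<inter> S)) * q ^ card S + real (card ({..<b} \<inter> - S)) * (q ^ card S * q)"
    by (simp add: sum.If_cases)
  also have "real (card ({..<b} \<inter> - S)) = real b - real r"
  proof -
    have "card {..<b} = card ({..<b} \<inter> S) + card ({..<b} \<inter> - S)"
      by (subst card_Un_disjoint[symmetric]) (auto simp flip: Int_Un_distrib)
    then show ?thesis by (simp add: r_def Int_commute)
  qed
  finally show ?thesis by (simp add: r_def Int_commute algebra_simps)
qed

text \<open>Hoeffding for the binomial number of survivors in each window: a deviation of
  \<open>\<mu> * sqrt (d * l)\<close> makes the window length \<open>d\<close> cancel in the
  exponent. Then a union bound over the windows.\<close>

lemma prob_unbalanced:
  assumes q: "0 \<le> q" "q \<le> 1" and l: "0 \<le> l" and \<mu>: "0 \<le> \<mu>"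
  shows "measure_pmf.prob (keep_pmf q n) {keep. \<not> balanced q l \<mu> n keep}
     \<le> 2 * (real n + 1)\<^sup>2 * exp (- 2 * \<mu>\<^sup>2 * l)"
proof -
  let ?P = "measure_pmf.prob (keep_pmf q n)"
  define I where "I = {(i, j). i < j \<and> j \<le> n}"
  have sub: "I \<subseteq> {..n} \<times> {..n}" by (auto simp: I_def)
  then have fI: "finite I" by (rule finite_subset) auto
  have "card I \<le> card ({..n} \<times> {..n})" using sub by (intro card_mono) auto
  then have "card I \<le> (n + 1)\<^sup>2" by (simp add: power2_eq_square)
  then have "real (card I) \<le> real ((n + 1)\<^sup>2)" by (simp only: of_nat_le_iff)
  then have cI: "real (card I) \<le> (real n + 1)\<^sup>2" by (simp add: add.commute)
  define bad where "bad = (\<lambda>(i, j). {keep.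
    \<mu> * sqrt ((real j - real i) * l) \<le> \<bar>real (card {l \<in> {i..<j}. keep l}) - (real j - real i) * q\<bar>})"
  have bad: "?P (bad ij) \<le> 2 * exp (- 2 * \<mu>\<^sup>2 * l)" if "ij \<in> I" for ij
  proof -
    obtain i j where ij: "ij = (i, j)" "i < j" "j \<le> n" using \<open>ij \<in> I\<close> by (auto simp: I_def)
    define d where "d = j - i"
    have d: "d > 0" "real j - real i = real d" using ij by (auto simp: d_def)
    let ?\<epsilon> = "\<mu> * sqrt (real d * l)"
    have "binomial_pmf d q = map_pmf (\<lambda>keep. card {l \<in> {i..<j}. keep l})
        (Pi_pmf {i..<j} False (\<lambda>_. bernoulli_pmf q))"
      using q by (intro binomial_pmf_altdef') (auto simp: d_def)
    also have "\<dots> = map_pmf (\<lambda>keep. card {l \<in> {i..<j}. keep l}) (keep_pmf q n)"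
      using ij by (subst Pi_pmf_subset[of "{..<n}"])
        (auto simp: map_pmf_comp intro!: map_pmf_cong arg_cong[of _ _ card])
    finally have "?P (bad ij) = measure_pmf.prob (binomial_pmf d q) {c. ?\<epsilon> \<le> \<bar>real c - real d * q\<bar>}"
      by (simp add: bad_def ij d vimage_def)
    also have "\<dots> \<le> 2 * exp (- 2 * ?\<epsilon>\<^sup>2 / real d)"
      using d \<mu> l q by (intro binomial_distribution.prob_abs_ge) (auto simp: binomial_distribution_def)
    also have "- 2 * ?\<epsilon>\<^sup>2 / real d = - 2 * \<mu>\<^sup>2 * l"
      using d l by (simp add: power_mult_distrib)
    finally show ?thesis .
  qed
  have "?P {keep. \<not> balanced q l \<mu> n keep} \<le> ?P (\<Union>ij\<in>I. bad ij)"
  proof (intro measure_pmf.finite_measure_mono subsetI)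
    fix keep assume "keep \<in> {keep. \<not> balanced q l \<mu> n keep}"
    then obtain i j where ij: "i < j" "j \<le> n" "\<not> \<bar>(real (rank keep j) - real (rank keep i)) - q * (real j - real i)\<bar>
        \<le> \<mu> * sqrt ((real j - real i) * l)"
      unfolding balanced_def by auto
    then have "keep \<in> bad (i, j)"
      by (simp add: bad_def rank_diff mult.commute)
    then show "keep \<in> (\<Union>ij\<in>I. bad ij)" using ij by (auto simp: I_def)
  qed simp
  also have "\<dots> \<le> (\<Sum>ij\<in>I. ?P (bad ij))"
    using fI by (intro measure_pmf.finite_measure_subadditive_finite) auto
  also have "\<dots> \<le> real (card I) * (2 * exp (- 2 * \<mu>\<^sup>2 * l))"
    using sum_bounded_above[of I "\<lambda>ij. ?P (bad ij)"] bad by auto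
  also have "\<dots> \<le> (real n + 1)\<^sup>2 * (2 * exp (- 2 * \<mu>\<^sup>2 * l))"
    using cI by (intro mult_right_mono) auto
  finally show ?thesis by (simp add: mult_ac)
qed

text \<open>Uniqueness of order isomorphisms of well-orders: if the maps agree below
  \<open>s\<close>, the value of either at \<open>s\<close> is taken by the other at a point not
  below \<open>s\<close>.\<close>

lemma strict_mono_on_image_unique:
  fixes f g :: "'a :: wellorder \<Rightarrow> 'b :: linorder"
  assumes f: "strict_mono_on S f" and g: "strict_mono_on S g" and im: "f ` S = g ` S" and s: "s \<in> S"
  shows "f s = g s"
  using s
proof (induction s rule: less_induct)
  case (less s)
  have *: "v s \<le> u s" if u: "strict_mono_on S u" and v: "strict_mono_on S v" and im: "u ` S = v ` S"
    and IH: "\<And>z. z \<in> S \<Longrightarrow> z < s \<Longrightarrow> u z = v z" for u v :: "'a \<Rightarrow> 'b"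
  proof -
    have "u s \<in> v ` S" using im less.prems by blast
    then obtain z where z: "z \<in> S" "u s = v z" by blast
    have "\<not> z < s"
    proof
      assume "z < s"
      then have "u z < u s" using strict_mono_onD[OF u z(1) less.prems] by simp
      then show False using IH z \<open>z < s\<close> by simp
    qed
    then have "v s \<le> v z"
      using strict_mono_onD[OF v less.prems z(1)] by (cases s z rule: linorder_cases) auto
    then show ?thesis using z by simp
  qed
  show ?case
  proof (rule order_antisym)
    show "g s \<le> f s" using less.IH by (intro *[OF f g im]) auto
    show "f s \<le> g s" using less.IH by (intro *[OF g f im[symmetric]]) auto
  qed
qed

subsection \<open>A distinguishing event\<close>

lemma prob_trace_pmf:
  "measure_pmf.prob (trace_pmf p x) A
     = measure_pmf.prob (keep_pmf (1 - p) (length x)) {keep. nths x {i. keep i} \<in> A}"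
  by (simp add: trace_pmf_def vimage_def)

text \<open>Inclusions of events will be known only for balanced deletions; the exceptional set is
  paid for additively.\<close>

lemma prob_mono_modulo:
  "A \<inter> G \<subseteq> B \<Longrightarrow> measure_pmf.prob M A \<le> measure_pmf.prob M B + measure_pmf.prob M (- G)"
proof -
  assume "A \<inter> G \<subseteq> B"
  then have "measure_pmf.prob M A \<le> measure_pmf.prob M (B \<union> - G)"
    by (intro measure_pmf.finite_measure_mono) auto
  also have "\<dots> \<le> measure_pmf.prob M B + measure_pmf.prob M (- G)"
    by (intro measure_Un_le) auto
  finally show ?thesis .
qed

text \<open>If no event separated \<open>x\<close> and \<open>y\<close>, comparing visibility of
  \<open>\<sigma>\<close> would force exactly one copy of \<open>\<sigma>\<close> in
  \<open>y\<close>, and comparing the mean visible position of \<open>a\<close> would then put this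
  copy's image of \<open>a\<close> at \<open>a\<close>, which is not a one of
  \<open>y\<close>.\<close>

lemma distinguishing_event:
  fixes p l \<mu> \<epsilon> :: real and x y :: "bool list"
  defines "q \<equiv> 1 - p"
  assumes p: "0 < p" "p < 1" and l: "0 \<le> l" and \<mu>: "0 \<le> \<mu>"
    and len: "length x = n" "length y = n"
    and \<sigma>: "\<sigma> \<subseteq> ones x" and a: "a \<in> \<sigma>" "a \<notin> ones y"
    and gap: "\<And>s s'. s \<in> \<sigma> \<Longrightarrow> s' \<in> \<sigma> \<Longrightarrow> s < s' \<Longrightarrow> (8 * \<mu> / q)\<^sup>2 * l \<le> real s' - real s"
    and rigid: "\<And>\<phi>. near l (8 * \<mu> / q) \<sigma> (ones x) \<phi> \<Longrightarrow> \<forall>z\<in>\<sigma>. \<phi> z = z"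
    and unbal: "measure_pmf.prob (keep_pmf q n) {keep. \<not> balanced q l \<mu> n keep} \<le> \<epsilon>"
    and eps: "\<epsilon> > 0" "8 * real n * \<epsilon> \<le> q ^ card \<sigma> * q" "8 * real n * \<epsilon> \<le> q ^ card \<sigma> * p"
  shows "\<exists>A. \<epsilon> \<le> \<bar>measure_pmf.prob (trace_pmf p x) A - measure_pmf.prob (trace_pmf p y) A\<bar>"
proof (rule ccontr)
  let ?P = "measure_pmf.prob (keep_pmf q n)"
  define \<Omega> where "\<Omega> = {keep. balanced q l \<mu> n keep}"
  define X where "X keep = nths x {i. keep i}" for keep
  define Y where "Y keep = nths y {i. keep i}" for keep
  \<comment> \<open>Visibility is used at two tolerances: \<open>2 * \<mu>\<close> is met by the
    exact copy in \<open>x\<close>, and \<open>6 * \<mu>\<close> by any copy in \<open>y\<close>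
    that could have been seen at tolerance \<open>2 * \<mu>\<close>.\<close>
  define V where "V c = {t. \<exists>\<psi>. valid q l c \<sigma> t \<psi>}" for c
  \<comment> \<open>The arbitrary choice is harmless: under balanced deletions all visible copies
    turn out to agree on where \<open>a\<close> is seen.\<close>
  define T where "T t = (SOME \<psi>. valid q l (2 * \<mu>) \<sigma> t \<psi>) a" for t
  define Q where "Q = q ^ card \<sigma>"
  assume "\<not> ?thesis"
  then have same: "\<bar>?P {keep. X keep \<in> A} - ?P {keep. Y keep \<in> A}\<bar> < \<epsilon>" for A
    by (simp add: prob_trace_pmf len X_def Y_def not_le flip: q_def)
  have q: "0 < q" "q < 1" using p by (auto simp: q_def)
  have n: "a < n" using a \<sigma> len by (auto simp: ones_def)
  have Q: "8 * real n * \<epsilon> \<le> Q * q" "8 * real n * \<epsilon> \<le> Q * p" "0 < Q"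
    using eps q by (auto simp: Q_def)
  have n1: "\<epsilon> \<le> real n * \<epsilon>" using n eps by (simp add: Suc_leI)
  have Qle: "Q * q \<le> Q" "Q * p \<le> Q" using q p Q by auto
  have \<sigma>n: "\<sigma> \<subseteq> {..<n}" using \<sigma> len by (auto simp: ones_def)
  then have fin: "finite \<sigma>" using finite_subset by blast
  have unbal': "?P (- \<Omega>) \<le> \<epsilon>" using unbal by (simp add: \<Omega>_def Compl_eq)
  have T: "valid q l (2 * \<mu>) \<sigma> t (SOME \<psi>. valid q l (2 * \<mu>) \<sigma> t \<psi>)" if "t \<in> V (2 * \<mu>)" for t
    using that someI_ex[of "valid q l (2 * \<mu>) \<sigma> t"] by (simp add: V_def)
  have valid_mono: "valid q l (6 * \<mu>) \<sigma> t \<psi>" if "valid q l (2 * \<mu>) \<sigma> t \<psi>" for t \<psi>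
  proof -
    have "2 * \<mu> * sqrt ((real s' - real s) * l) \<le> 6 * \<mu> * sqrt ((real s' - real s) * l)" if "s < s'" for s s' :: nat
      using that \<mu> l by (intro mult_right_mono) auto
    then show ?thesis using that unfolding valid_def by (meson order_trans)
  qed
  have gap': "c\<^sup>2 * l \<le> real s' - real s" if "s \<in> \<sigma>" "s' \<in> \<sigma>" "s < s'" "0 \<le> c" "c \<le> 8 * \<mu> / q" for c s s'
  proof -
    have "c\<^sup>2 * l \<le> (8 * \<mu> / q)\<^sup>2 * l" using that l by (intro mult_right_mono power_mono) auto
    then show ?thesis using gap[OF that(1-3)] by linarith
  qed

  \<comment> \<open>Visibility of \<open>\<sigma>\<close> in traces of \<open>x\<close>\<close>
  have X1: "X keep \<in> V (2 * \<mu>)" if "keep \<in> \<Omega>" "keep \<in> all_kept \<sigma>" for keep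
  proof -
    have "near l 0 \<sigma> (ones x) (\<lambda>s. s)" using \<sigma> by (auto simp: near_def strict_mono_on_def)
    then have "valid q l (2 * \<mu> + q * 0) \<sigma> (X keep) (rank keep \<circ> (\<lambda>s. s))"
      unfolding X_def using that q l \<mu> gap len
      by (intro near_imp_valid) (auto simp: \<Omega>_def all_kept_def)
    then show ?thesis by (auto simp: V_def)
  qed
  \<comment> \<open>The tolerance \<open>6 * \<mu>\<close> and the \<open>2 * \<mu>\<close> lost in
    passing from trace to string give the 8 in the rigidity hypothesis.\<close>
  have X3: "keep \<in> all_kept \<sigma> \<and> \<psi> a = rank keep a"
    if keep: "keep \<in> \<Omega>" and val: "valid q l (6 * \<mu>) \<sigma> (X keep) \<psi>" for keep \<psi>
  proof -
    obtain \<phi> where \<phi>: "near l ((6 * \<mu> + 2 * \<mu>) / q) \<sigma> (ones x) \<phi>"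
      "\<And>s. s \<in> \<sigma> \<Longrightarrow> keep (\<phi> s)" "\<And>s. s \<in> \<sigma> \<Longrightarrow> \<psi> s = rank keep (\<phi> s)"
    proof (rule valid_imp_near[OF q(1) less_imp_le[OF q(2)] l \<mu>])
      show "valid q l (6 * \<mu>) \<sigma> (nths x {i. keep i}) \<psi>" using val by (simp add: X_def)
      show "balanced q l \<mu> (length x) keep" using keep len by (simp add: \<Omega>_def)
      show "((6 * \<mu> + 2 * \<mu>) / q)\<^sup>2 * l \<le> real s' - real s" if "s \<in> \<sigma>" "s' \<in> \<sigma>" "s < s'" for s s'
        using gap[OF that] by simp
    qed (use \<mu> in auto)
    have "\<forall>z\<in>\<sigma>. \<phi> z = z" using \<phi>(1) by (intro rigid) simp
    then show ?thesis using \<phi> a by (auto simp: all_kept_def)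
  qed
  have PX: "?P (all_kept \<sigma>) = Q" using q \<sigma>n by (simp add: prob_all_kept Q_def)
  have PX1: "Q - \<epsilon> \<le> ?P {keep. X keep \<in> V (2 * \<mu>)}"
    using prob_mono_modulo[of "all_kept \<sigma>" \<Omega> "{keep. X keep \<in> V (2 * \<mu>)}" "keep_pmf q n"] X1 PX unbal' by force
  have PX3: "?P {keep. X keep \<in> V (6 * \<mu>)} \<le> Q + \<epsilon>"
    using prob_mono_modulo[of "{keep. X keep \<in> V (6 * \<mu>)}" \<Omega> "all_kept \<sigma>" "keep_pmf q n"] X3 PX unbal'
    by (force simp: V_def)

  \<comment> \<open>Exactly the tolerance that visibility at \<open>2 * \<mu>\<close> yields in
    \<open>y\<close>. Members may differ arbitrarily off \<open>\<sigma>\<close>, so uniqueness can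
    hold only on \<open>\<sigma>\<close>.\<close>
  define N where "N = {\<phi>. near l (4 * \<mu> / q) \<sigma> (ones y) \<phi>}"
  have Nn: "\<phi> ` \<sigma> \<subseteq> {..<n}" "card (\<phi> ` \<sigma>) = card \<sigma>" if "\<phi> \<in> N" for \<phi>
    using that len by (auto simp: N_def near_def ones_def strict_mono_on_imp_inj_on card_image)
  have PN: "?P (all_kept (\<phi> ` \<sigma>)) = Q" if "\<phi> \<in> N" for \<phi>
    using q Nn[OF that] by (simp add: prob_all_kept Q_def)
  have Y1: "\<exists>\<phi>\<in>N. keep \<in> all_kept (\<phi> ` \<sigma>) \<and> \<psi> a = rank keep (\<phi> a)"
    if keep: "keep \<in> \<Omega>" and val: "valid q l (2 * \<mu>) \<sigma> (Y keep) \<psi>" for keep \<psi>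
  proof -
    obtain \<phi> where \<phi>: "near l ((2 * \<mu> + 2 * \<mu>) / q) \<sigma> (ones y) \<phi>"
      "\<And>s. s \<in> \<sigma> \<Longrightarrow> keep (\<phi> s)" "\<And>s. s \<in> \<sigma> \<Longrightarrow> \<psi> s = rank keep (\<phi> s)"
    proof (rule valid_imp_near[OF q(1) less_imp_le[OF q(2)] l \<mu>])
      show "valid q l (2 * \<mu>) \<sigma> (nths y {i. keep i}) \<psi>" using val by (simp add: Y_def)
      show "balanced q l \<mu> (length y) keep" using keep len by (simp add: \<Omega>_def)
      show "((2 * \<mu> + 2 * \<mu>) / q)\<^sup>2 * l \<le> real s' - real s" if "s \<in> \<sigma>" "s' \<in> \<sigma>" "s < s'" for s s'
        using q \<mu> by (intro gap'[OF that]) (auto simp: divide_right_mono)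
    qed (use \<mu> in auto)
    then show ?thesis using a by (intro bexI[of _ \<phi>]) (auto simp: N_def all_kept_def)
  qed
  have Y3: "Y keep \<in> V (6 * \<mu>)" if "keep \<in> \<Omega>" "\<phi> \<in> N" "keep \<in> all_kept (\<phi> ` \<sigma>)" for keep \<phi>
  proof -
    have "valid q l (2 * \<mu> + q * (4 * \<mu> / q)) \<sigma> (Y keep) (rank keep \<circ> \<phi>)"
      unfolding Y_def
    proof (rule near_imp_valid[OF q(1) less_imp_le[OF q(2)] l \<mu>])
      show "(4 * \<mu> / q)\<^sup>2 * l \<le> real s' - real s" if "s \<in> \<sigma>" "s' \<in> \<sigma>" "s < s'" for s s'
        using q \<mu> by (intro gap'[OF that]) (auto simp: divide_right_mono)
    qed (use that q \<mu> len in \<open>auto simp: \<Omega>_def all_kept_def N_def\<close>)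
    then show ?thesis using q by (auto simp: V_def)
  qed

  \<comment> \<open>Without a copy, visibility has probability at most \<open>\<epsilon>\<close> for
    \<open>y\<close> but at least \<open>Q - \<epsilon>\<close> for \<open>x\<close>.\<close>
  have "N \<noteq> {}"
  proof
    assume "N = {}"
    then have "?P {keep. Y keep \<in> V (2 * \<mu>)} \<le> ?P {} + ?P (- \<Omega>)"
      using Y1 by (intro prob_mono_modulo) (auto simp: V_def)
    then show False using same[of "V (2 * \<mu>)"] PX1 unbal' Q Qle n1 eps by simp
  qed
  then obtain \<phi> where \<phi>: "\<phi> \<in> N" by blast
  \<comment> \<open>Two copies have different images of equal size, so one contains a point
    \<open>b\<close> outside the other. Both survive with probability at most \<open>Q * q\<close>,
    so by inclusion-exclusion at least one survives with probability at least
    \<open>Q + Q * p\<close>, too much for \<open>x\<close> to match.\<close>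
  have uniq: "\<phi>' s = \<phi> s" if \<phi>': "\<phi>' \<in> N" and s: "s \<in> \<sigma>" for \<phi>' s
  proof (rule ccontr)
    assume ne: "\<phi>' s \<noteq> \<phi> s"
    have "\<phi>' ` \<sigma> \<noteq> \<phi> ` \<sigma>"
      using strict_mono_on_image_unique[of \<sigma> \<phi>' \<phi> s] ne \<phi> \<phi>' s by (auto simp: N_def near_def)
    then have "\<not> \<phi>' ` \<sigma> \<subseteq> \<phi> ` \<sigma>"
      using card_subset_eq[of "\<phi> ` \<sigma>" "\<phi>' ` \<sigma>"] fin Nn \<phi> \<phi>' by auto
    then obtain b where b: "b \<in> \<phi>' ` \<sigma>" "b \<notin> \<phi> ` \<sigma>" by blast
    have "?P (all_kept (\<phi>' ` \<sigma>)) + ?P (all_kept (\<phi> ` \<sigma>)) 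
        = ?P (all_kept (\<phi>' ` \<sigma>) \<union> all_kept (\<phi> ` \<sigma>)) + ?P (all_kept (\<phi>' ` \<sigma>) \<inter> all_kept (\<phi> ` \<sigma>))"
      by (subst measure_pmf.finite_measure_Union') (auto simp: measure_pmf.finite_measure_Diff' Int_commute)
    moreover have "?P (all_kept (\<phi>' ` \<sigma>) \<inter> all_kept (\<phi> ` \<sigma>)) \<le> ?P (all_kept (insert b (\<phi> ` \<sigma>)))"
      using b by (intro measure_pmf.finite_measure_mono) (auto simp: all_kept_def)
    moreover have "?P (all_kept (insert b (\<phi> ` \<sigma>))) = Q * q"
      using q b Nn[OF \<phi>] Nn[OF \<phi>'] fin by (subst prob_all_kept) (auto simp: Q_def)
    ultimately have "Q + Q * p \<le> ?P (all_kept (\<phi>' ` \<sigma>) \<union> all_kept (\<phi> ` \<sigma>))"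
      using PN[OF \<phi>] PN[OF \<phi>'] by (simp add: q_def algebra_simps)
    also have "\<dots> \<le> ?P {keep. Y keep \<in> V (6 * \<mu>)} + ?P (- \<Omega>)"
      using Y3 \<phi> \<phi>' by (intro prob_mono_modulo) auto
    finally show False using same[of "V (6 * \<mu>)"] PX3 unbal' Q n1 eps by linarith
  qed

  \<comment> \<open>Mean position of the unique copy\<close>
  define b where "b = \<phi> a"
  define S where "S = \<phi> ` \<sigma>"
  have bS: "b \<in> S" "b < n" "b \<noteq> a"
    using a \<phi> Nn[OF \<phi>] by (auto simp: b_def S_def N_def near_def)
  let ?RY = "{keep. Y keep \<in> V (2 * \<mu>)}"
  have YT: "keep \<in> all_kept S \<and> T (Y keep) = rank keep b" if keep: "keep \<in> \<Omega>" "Y keep \<in> V (2 * \<mu>)" for keep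
  proof -
    obtain \<phi>' where \<phi>': "\<phi>' \<in> N" "keep \<in> all_kept (\<phi>' ` \<sigma>)" "T (Y keep) = rank keep (\<phi>' a)"
      using Y1[OF keep(1) T[OF keep(2)]] unfolding T_def by blast
    have "\<phi>' ` \<sigma> = S" "\<phi>' a = b" using uniq[OF \<phi>'(1)] a by (auto simp: S_def b_def)
    then show ?thesis using \<phi>' by simp
  qed
  have XT: "keep \<in> all_kept \<sigma> \<and> T (X keep) = rank keep a" if "keep \<in> \<Omega>" "X keep \<in> V (2 * \<mu>)" for keep
    using X3[OF that(1) valid_mono[OF T[OF that(2)]]] by (simp add: T_def)
  \<comment> \<open>A surviving copy in \<open>y\<close> is only guaranteed to be visible at
    tolerance \<open>6 * \<mu>\<close>. That it is rarely missed at \<open>2 * \<mu>\<close> follows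
    from the comparison with \<open>x\<close>, where visibility has probability at least
    \<open>Q - \<epsilon>\<close>.\<close>
  have lost: "?P (all_kept S - ?RY) \<le> 3 * \<epsilon>"
  proof -
    have "?P ?RY \<le> ?P (all_kept S \<inter> ?RY) + ?P (- \<Omega>)"
      using YT by (intro prob_mono_modulo) auto
    moreover have "?P (all_kept S - ?RY) = ?P (all_kept S) - ?P (all_kept S \<inter> ?RY)"
      by (simp add: measure_pmf.finite_measure_Diff')
    ultimately show ?thesis using same[of "V (2 * \<mu>)"] PX1 unbal' PN[OF \<phi>] unfolding S_def by linarith
  qed
  \<comment> \<open>Summing over \<open>j\<close> the probabilities that a copy is visible with \<open>a\<close> seen beyond \<open>j\<close> yields
    the mean position.\<close>
  have per_j: "\<bar>?P (all_kept \<sigma> \<inter> {keep. j < rank keep a}) - ?P (all_kept S \<inter> {keep. j < rank keep b})\<bar> \<le> 7 * \<epsilon>" for j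
  proof -
    let ?A = "V (2 * \<mu>) \<inter> {t. j < T t}"
    let ?KX = "all_kept \<sigma> \<inter> {keep. j < rank keep a}" and ?KY = "all_kept S \<inter> {keep. j < rank keep b}"
    have "?P {keep. X keep \<in> ?A} \<le> ?P ?KX + ?P (- \<Omega>)"
      using XT by (intro prob_mono_modulo) auto
    moreover have "?P ?KX \<le> ?P {keep. X keep \<in> ?A} + ?P (- \<Omega>)"
      using XT X1 by (intro prob_mono_modulo) auto
    moreover have "?P {keep. Y keep \<in> ?A} \<le> ?P ?KY + ?P (- \<Omega>)"
      using YT by (intro prob_mono_modulo) auto
    moreover have "?P ?KY \<le> ?P ({keep. Y keep \<in> ?A} \<union> (all_kept S - ?RY)) + ?P (- \<Omega>)"
      using YT by (intro prob_mono_modulo) auto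
    moreover have "?P ({keep. Y keep \<in> ?A} \<union> (all_kept S - ?RY)) \<le> ?P {keep. Y keep \<in> ?A} + ?P (all_kept S - ?RY)"
      by (intro measure_Un_le) auto
    ultimately show ?thesis using same[of ?A] lost unbal' by linarith
  qed
  \<comment> \<open>As \<open>\<phi>\<close> is increasing, as many anchors precede \<open>b\<close>
    in \<open>S\<close> as precede \<open>a\<close> in \<open>\<sigma>\<close>; hence the means
    differ by exactly \<open>Q * q * (a - b)\<close>.\<close>
  define r where "r = card (\<sigma> \<inter> {..<a})"
  have r: "card (S \<inter> {..<b}) = r"
  proof -
    have mono: "strict_mono_on \<sigma> \<phi>" using \<phi> by (auto simp: N_def near_def)
    then have "S \<inter> {..<b} = \<phi> ` (\<sigma> \<inter> {..<a})"
      using strict_mono_on_less[OF mono _ a(1)] by (auto simp: S_def b_def)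
    moreover have "inj_on \<phi> (\<sigma> \<inter> {..<a})"
      by (rule inj_on_subset[OF strict_mono_on_imp_inj_on[OF mono]]) auto
    ultimately show ?thesis by (simp add: card_image r_def)
  qed
  have sumX: "(\<Sum>j<n. ?P (all_kept \<sigma> \<inter> {keep. j < rank keep a})) = Q * (real r + q * (real a - real r))"
    using q \<sigma>n n by (subst sum_prob_rank) (auto simp: Q_def r_def)
  have sumY: "(\<Sum>j<n. ?P (all_kept S \<inter> {keep. j < rank keep b})) = Q * (real r + q * (real b - real r))"
    using q Nn[OF \<phi>] bS r by (subst sum_prob_rank) (auto simp: Q_def S_def)
  have "\<bar>Q * q * (real a - real b)\<bar> = \<bar>\<Sum>j<n. ?P (all_kept \<sigma> \<inter> {keep. j < rank keep a})
      - ?P (all_kept S \<inter> {keep. j < rank keep b})\<bar>"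
    unfolding sum_subtractf sumX sumY by (simp add: algebra_simps)
  also have "\<dots> \<le> (\<Sum>j<n. 7 * \<epsilon>)"
    using per_j by (intro order_trans[OF sum_abs] sum_mono)
  finally have "Q * q * \<bar>real a - real b\<bar> \<le> 7 * real n * \<epsilon>"
    using Q q by (simp add: abs_mult)
  \<comment> \<open>Distinct positions differ by at least 1, so \<open>Q * q\<close> would be at
    most \<open>7 * n * \<epsilon>\<close>, against the choice of \<open>\<epsilon>\<close>.\<close>
  moreover have "Q * q * 1 \<le> Q * q * \<bar>real a - real b\<bar>"
    using Q q bS by (intro mult_left_mono) auto
  ultimately show False using Q(1) n1 eps(1) by linarith
qed

subsection \<open>Recovery of separated strings\<close>

lemma zero_runs_distance:
  assumes "zero_runs_at_least g x" "i \<in> ones x" "j \<in> ones x" "i < j"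
  shows "g \<le> real j - real i"
proof -
  define J where "J = {j \<in> ones x. i < j}"
  have "finite J" by (rule finite_subset[of _ "{..<length x}"]) (auto simp: J_def ones_def)
  moreover have "j \<in> J" using assms by (simp add: J_def)
  ultimately have "Min J \<in> J" "Min J \<le> j" "\<And>l. l \<in> J \<Longrightarrow> Min J \<le> l" by (auto intro: Min_in)
  then have "consecutive_ones x i (Min J)"
    using assms(2) unfolding consecutive_ones_def J_def by (auto simp: not_le[symmetric])
  then have "g \<le> real (Min J - i - 1)" using assms(1) by (simp add: zero_runs_at_least_def)
  also have "\<dots> \<le> real j - real i" using \<open>Min J \<le> j\<close> assms(4) by linarith
  finally show ?thesis .
qed

text \<open>Take the least such \<open>L\<close>: the previous double power is below
  \<open>N\<close>, and its square is the next one. This overshoot by at most a square keeps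
  \<open>2 ^ L\<close> logarithmic in \<open>N\<close>.\<close>

lemma double_power_ge:
  fixes N :: real
  assumes "2 \<le> N"
  obtains L where "N \<le> 2 ^ (2 ^ L)" "2 ^ (2 ^ L) \<le> N\<^sup>2"
proof -
  obtain m where "N < 2 ^ m" using real_arch_pow[of 2 N] by auto
  also have "(2::real) ^ m \<le> 2 ^ (2 ^ m)" by (intro power_increasing) (auto intro: less_imp_le less_exp)
  finally have ex: "N \<le> 2 ^ (2 ^ m)" by simp
  define L where "L = (LEAST L. N \<le> 2 ^ (2 ^ L))"
  have L: "N \<le> 2 ^ (2 ^ L)" unfolding L_def using ex by (rule LeastI)
  moreover have "2 ^ (2 ^ L) \<le> N\<^sup>2"
  proof (cases L)
    case 0
    then show ?thesis using assms mult_mono[of 1 N 2 N] by (simp add: power2_eq_square)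
  next
    case (Suc L')
    then have "\<not> N \<le> 2 ^ (2 ^ L')" using not_less_Least[of L' "\<lambda>L. N \<le> 2 ^ (2 ^ L)"] by (simp add: L_def)
    then have "(2 ^ (2 ^ L'))\<^sup>2 \<le> N\<^sup>2" by (intro power_mono) auto
    then show ?thesis using Suc by (simp add: mult.commute flip: power_mult)
  qed
  ultimately show thesis using that by blast
qed

text \<open>The value \<open>5 * b + 3\<close> gives the tail \<open>1 / n ^ (10 * b + 6)\<close>.
  For \<open>8 \<le> n\<close> this absorbs the union bound factor, at most \<open>n ^ 3\<close>,
  and \<open>(8 * n) ^ (5 * b + 1)\<close>, at most \<open>n ^ (10 * b + 2)\<close>.\<close>

lemma prob_unbalanced_le:
  fixes b n :: nat
  assumes q: "0 \<le> q" "q \<le> 1" and n: "8 \<le> n"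
  shows "measure_pmf.prob (keep_pmf q n) {keep. \<not> balanced q (ln n) (sqrt (5 * b + 3)) n keep}
     \<le> 1 / (8 * real n) ^ (5 * b + 1)"
proof -
  have "exp (- 2 * (sqrt (5 * b + 3))\<^sup>2 * ln n) = 1 / real n ^ (10 * b + 6)"
  proof -
    have "exp (- 2 * (sqrt (5 * b + 3))\<^sup>2 * ln n) = exp (- (real (10 * b + 6) * ln n))"
      by (simp add: algebra_simps)
    also have "\<dots> = inverse (exp (real (10 * b + 6) * ln n))" by (rule exp_minus)
    also have "exp (real (10 * b + 6) * ln n) = real n ^ (10 * b + 6)"
      using n by (simp only: exp_of_nat_mult) simp
    finally show ?thesis by (simp add: inverse_eq_divide)
  qed
  then have "measure_pmf.prob (keep_pmf q n) {keep. \<not> balanced q (ln n) (sqrt (5 * b + 3)) n keep}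
      \<le> 2 * (real n + 1)\<^sup>2 * (1 / real n ^ (10 * b + 6))"
    using prob_unbalanced[OF q, of "ln n" "sqrt (5 * b + 3)" n] n by simp
  also have "\<dots> \<le> 1 / (8 * real n) ^ (5 * b + 1)"
  proof -
    have "2 * (real n + 1)\<^sup>2 \<le> 2 * (2 * real n)\<^sup>2"
      using n by (intro mult_left_mono power_mono) auto
    also have "\<dots> = 8 * real n ^ 2" by (simp add: power_mult_distrib)
    also have "\<dots> \<le> real n * real n ^ 2" using n by (intro mult_right_mono) auto
    finally have 1: "2 * (real n + 1)\<^sup>2 \<le> real n ^ 3" by (simp add: power3_eq_cube power2_eq_square)
    have "(8 * real n) ^ (5 * b + 1) \<le> (real n * real n) ^ (5 * b + 1)"
      using n by (intro power_mono mult_right_mono) auto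
    also have "\<dots> = real n ^ (10 * b + 2)" by (simp flip: power2_eq_square power_mult)
    finally have "2 * (real n + 1)\<^sup>2 * (8 * real n) ^ (5 * b + 1) \<le> real n ^ 3 * real n ^ (10 * b + 2)"
      using 1 by (intro mult_mono) auto
    also have "\<dots> \<le> real n ^ (10 * b + 6)"
      using n by (subst power_add[symmetric], intro power_increasing) auto
    finally show ?thesis using n by (simp add: divide_simps mult.commute)
  qed
  finally show ?thesis .
qed

lemma separated_strings_test:
  fixes p C :: real and b n k :: nat
  assumes p: "0 < p" "p < 1" and b: "1 / 2 ^ b \<le> p" "1 / 2 ^ b \<le> 1 - p" and n: "8 \<le> n"
    and C: "C = 6400 * (5 * b + 3) / (1 - p)\<^sup>2"
    and x: "length x = n" "card (ones x) \<le> k" "zero_runs_at_least (C * real k * ln n) x"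
    and y: "length y = n" and a: "a \<in> ones x" "a \<notin> ones y"
  shows "\<exists>A. 1 / (8 * real n) ^ (5 * b + 1)
    \<le> \<bar>measure_pmf.prob (trace_pmf p x) A - measure_pmf.prob (trace_pmf p y) A\<bar>"
proof -
  define q \<mu> g where "q = 1 - p" and "\<mu> = sqrt (5 * b + 3)" and "g = C * real k * ln n"
  have q: "0 < q" "q < 1" using p by (auto simp: q_def)
  have fin: "finite (ones x)" by (auto simp: ones_def)
  then have k: "1 \<le> k" using a x card_gt_0_iff[of "ones x"] by auto
  have "exp 1 \<le> (8::real)" using exp_le by simp
  then have ln1: "1 \<le> ln n" using n by (subst ln_ge_iff) auto
  \<comment> \<open>Explains \<open>C\<close>: it is the 100 of the rigidity lemma times the square
    of the tolerance \<open>8 * \<mu> / q\<close>.\<close>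
  have sq: "(8 * \<mu> / q)\<^sup>2 = C / 100"
    by (simp add: power_divide power_mult_distrib \<mu>_def C q_def mult.commute add_divide_distrib)
  then have c100: "100 * (8 * \<mu> / (1 - p))\<^sup>2 = C" unfolding q_def by linarith
  have "q\<^sup>2 \<le> 1" using q by (simp add: power_le_one)
  then have C1: "1 \<le> C" using q by (simp add: C divide_simps flip: q_def)
  have g1: "1 \<le> g"
  proof -
    have "1 * 1 * 1 \<le> C * real k * ln n" using C1 k ln1 by (intro mult_mono) auto
    then show ?thesis by (simp add: g_def)
  qed
  have gap: "g \<le> real j - real i" if "i \<in> ones x" "j \<in> ones x" "i < j" for i j
    using zero_runs_distance[OF x(3)] that by (simp add: g_def)
  obtain L where L: "8 * real n \<le> 2 ^ (2 ^ L)" "2 ^ (2 ^ L) \<le> (8 * real n)\<^sup>2"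
    using double_power_ge[of "8 * real n"] n by auto
  define \<sigma> where "\<sigma> = anchors (ones x) g L a"
  have \<sigma>: "\<sigma> \<subseteq> ones x" using anchors_subset fin a by (simp add: \<sigma>_def)
  have card\<sigma>: "card \<sigma> \<le> 2 * 2 ^ L" using card_anchors[OF fin _ a(1), of g L] g1 by (simp add: \<sigma>_def)
  \<comment> \<open>As \<open>q\<close> is at least \<open>1 / 2 ^ b\<close>, survival of
    \<open>2 * 2 ^ L\<close> anchors costs at most \<open>2 ^ (2 ^ L)\<close> to the power
    \<open>2 * b\<close>, and \<open>2 ^ (2 ^ L)\<close> is at most the square of
    \<open>8 * n\<close>.\<close>
  have Q: "1 / (8 * real n) ^ (4 * b) \<le> q ^ card \<sigma>"
  proof -
    have "(8 * real n) ^ (4 * b) = ((8 * real n)\<^sup>2) ^ (2 * b)"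
      by (subst power_mult[symmetric]) (rule arg_cong[of _ _ "power _"], simp)
    then have "1 / (8 * real n) ^ (4 * b) = 1 / ((8 * real n)\<^sup>2) ^ (2 * b)" by (simp only:)
    also have "\<dots> \<le> 1 / (2 ^ (2 ^ L)) ^ (2 * b)"
      using L n by (intro divide_left_mono power_mono) auto
    also have "\<dots> = (1 / 2 ^ b) ^ (2 * 2 ^ L)"
      by (simp add: power_one_over mult_ac flip: power_mult)
    also have "\<dots> \<le> q ^ (2 * 2 ^ L)" using b q by (intro power_mono) (auto simp: q_def)
    also have "\<dots> \<le> q ^ card \<sigma>" using card\<sigma> q by (intro power_decreasing) auto
    finally show ?thesis .
  qed
  \<comment> \<open>One more factor \<open>(8 * n) ^ b\<close> in the denominator pays for
    \<open>s\<close>, which will be \<open>p\<close> or \<open>1 - p\<close>.\<close>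
  have room: "8 * real n * (1 / (8 * real n) ^ (5 * b + 1)) \<le> q ^ card \<sigma> * s" if s: "1 / 2 ^ b \<le> s" for s
  proof -
    have "(8 * real n) ^ (5 * b + 1) = 8 * real n * ((8 * real n) ^ (4 * b) * (8 * real n) ^ b)"
      unfolding power_add[symmetric] power_Suc[symmetric] by (rule arg_cong[of _ _ "power _"]) simp
    then have "8 * real n * (1 / (8 * real n) ^ (5 * b + 1)) = 1 / (8 * real n) ^ (4 * b) * (1 / (8 * real n) ^ b)"
      using n by simp
    also have "\<dots> \<le> 1 / (8 * real n) ^ (4 * b) * (1 / 2 ^ b)"
      using n by (intro mult_left_mono divide_left_mono power_mono) auto
    also have "\<dots> \<le> q ^ card \<sigma> * s" using Q s q by (intro mult_mono) auto
    finally show ?thesis .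
  qed
  show ?thesis
  proof (rule distinguishing_event[where \<sigma> = \<sigma> and l = "ln n" and \<mu> = \<mu> and n = n, OF p])
    show "(8 * \<mu> / (1 - p))\<^sup>2 * ln n \<le> real s' - real s" if "s \<in> \<sigma>" "s' \<in> \<sigma>" "s < s'" for s s'
    proof -
      have "(8 * \<mu> / (1 - p))\<^sup>2 * ln n = C / 100 * 1 * ln n" using sq by (simp add: q_def)
      also have "\<dots> \<le> C * real k * ln n" using C1 k ln1 by (intro mult_right_mono mult_mono) auto
      also have "\<dots> \<le> real s' - real s" using gap[of s s'] that \<sigma> by (auto simp: g_def)
      finally show ?thesis .
    qed
    show "\<forall>z\<in>\<sigma>. \<phi> z = z" if near: "near (ln n) (8 * \<mu> / (1 - p)) \<sigma> (ones x) \<phi>" for \<phi>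
      unfolding \<sigma>_def
    proof (rule anchors_rigid[OF fin x(2) gap])
      show "100 * (8 * \<mu> / (1 - p))\<^sup>2 * real k * ln n \<le> g"
        unfolding c100 g_def by simp
      show "near (ln n) (8 * \<mu> / (1 - p)) (anchors (ones x) g L a) (ones x) \<phi>" using near by (simp add: \<sigma>_def)
      have "\<phi> a \<in> ones x" using near anchors_self by (auto simp: near_def \<sigma>_def)
      then have "\<bar>real (\<phi> a) - real a\<bar> < real n" using a x by (auto simp: ones_def)
      \<comment> \<open>The largest scale is at least \<open>2 * n\<close>, so any displacement
        within the string is small enough to start the descent.\<close>
      also have "8 * real n \<le> g * 2 ^ (2 ^ L)" using L g1 mult_mono[of 1 g "8 * real n" "2 ^ (2 ^ L)"] by simp
      then have "real n \<le> gap_scale g L / 2" by (simp add: gap_scale_def)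
      finally show "\<bar>real (\<phi> a) - real a\<bar> < gap_scale g L / 2" .
    qed (use g1 ln1 q a in \<open>auto simp: \<mu>_def q_def\<close>)
    show "measure_pmf.prob (keep_pmf (1 - p) n) {keep. \<not> balanced (1 - p) (ln n) \<mu> n keep}
        \<le> 1 / (8 * real n) ^ (5 * b + 1)"
      unfolding \<mu>_def using p n by (intro prob_unbalanced_le) auto
    show "8 * real n * (1 / (8 * real n) ^ (5 * b + 1)) \<le> (1 - p) ^ card \<sigma> * (1 - p)"
      "8 * real n * (1 / (8 * real n) ^ (5 * b + 1)) \<le> (1 - p) ^ card \<sigma> * p"
      using room[of "1 - p"] room[of p] b by (auto simp: q_def)
  qed (use x y a \<sigma> n anchors_self ln1 in \<open>auto simp: \<mu>_def \<sigma>_def\<close>)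
qed

theorem theorem2:
  fixes p :: real
  assumes "0 < p" and "p < 1"
  shows "\<exists>C::real. C > 0 \<and>
    (\<exists>(N :: nat \<Rightarrow> nat) (d :: nat) (\<delta> :: nat \<Rightarrow> real).
       (\<lambda>n. real (N n)) \<in> O(\<lambda>n. real n ^ d) \<and> \<delta> \<longlonglongrightarrow> 0 \<and>
       (\<forall>n k. \<exists>recover :: bool list list \<Rightarrow> bool list. \<forall>x.
          length x = n \<and> card (ones x) \<le> k \<and>
          zero_runs_at_least (C * real k * ln (real n)) x \<longrightarrow>
          measure_pmf.prob (traces_pmf p (N n) x) {ts. recover ts = x} \<ge> 1 - \<delta> n))"
proof -
  \<comment> \<open>An integer exponent bounding both \<open>p\<close> and \<open>1 - p\<close> from
    below turns all estimates into integer powers of \<open>8 * n\<close>.\<close>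
  obtain b where b: "1 / 2 ^ b < min p (1 - p)"
    using real_arch_pow_inv[of "min p (1 - p)" "1 / 2"] assms by (auto simp: power_one_over)
  define C where "C = 6400 * (5 * b + 3) / (1 - p)\<^sup>2"
  \<comment> \<open>This is \<open>4 * n\<close> over the squared test gap, so the Hoeffding
    exponent becomes \<open>2 * n\<close> and beats the at most \<open>2 ^ n\<close>
    candidates.\<close>
  define N where "N n = 4 * n * (8 * n) ^ (10 * b + 2)" for n :: nat
  \<comment> \<open>The value 1 makes the claim trivial for \<open>n < 8\<close>, where the
    estimates do not apply.\<close>
  define \<delta> where "\<delta> n = (if n < 8 then 1 else 2 * (2 * exp (- 2)) ^ n :: real)" for n :: nat
  have "C > 0" using assms by (simp add: C_def)
  moreover have "(\<lambda>n. real (N n)) \<in> O(\<lambda>n. real n ^ (10 * b + 3))"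
    by (rule bigoI[of _ "4 * 8 ^ (10 * b + 2)"])
      (simp add: N_def power_mult_distrib power_add power3_eq_cube power2_eq_square)
  moreover have "\<delta> \<longlonglongrightarrow> 0"
  proof -
    have "2 * exp (- 2) < (1::real)"
      using exp_ge_add_one_self[of 2] by (simp add: exp_minus divide_simps)
    then have "(\<lambda>n. 2 * (2 * exp (- 2)) ^ n) \<longlonglongrightarrow> 2 * (0::real)"
      by (intro tendsto_mult tendsto_const LIMSEQ_power_zero) simp
    moreover have "\<forall>\<^sub>F n in sequentially. 2 * (2 * exp (- 2)) ^ n = \<delta> n"
      using eventually_ge_at_top[of 8] by eventually_elim (simp add: \<delta>_def)
    ultimately show ?thesis using Lim_transform_eventually by (metis mult_zero_right)
  qed
  moreover have "\<exists>recover. \<forall>x. length x = n \<and> card (ones x) \<le> k \<and>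
      zero_runs_at_least (C * real k * ln (real n)) x \<longrightarrow>
      measure_pmf.prob (traces_pmf p (N n) x) {ts. recover ts = x} \<ge> 1 - \<delta> n" for n k
  proof (cases "n < 8")
    case False
    define X where "X = {x. length x = n \<and> card (ones x) \<le> k \<and> zero_runs_at_least (C * real k * ln (real n)) x}"
    let ?U = "{x :: bool list. set x \<subseteq> UNIV \<and> length x = n}"
    have U: "finite ?U" "card ?U = 2 ^ n"
      using finite_lists_length_eq[of "UNIV :: bool set" n] card_lists_length_eq[of "UNIV :: bool set" n] by auto
    have sub: "X \<subseteq> ?U" by (auto simp: X_def)
    define \<epsilon> where "\<epsilon> = 1 / (8 * real n) ^ (5 * b + 1)"
    have test: "\<exists>A. \<epsilon> \<le> \<bar>measure_pmf.prob (trace_pmf p x) A - measure_pmf.prob (trace_pmf p y) A\<bar>"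
      if xy: "x \<in> X" "y \<in> X" "a \<in> ones x" "a \<notin> ones y" for x y a
      unfolding \<epsilon>_def using xy b False
      by (intro separated_strings_test[OF assms, where C = C and k = k and a = a]) (auto simp: C_def X_def)
    have test': "\<exists>A. \<epsilon> \<le> \<bar>measure_pmf.prob (trace_pmf p x) A - measure_pmf.prob (trace_pmf p y) A\<bar>"
      if xy: "x \<in> X" "y \<in> X" "x \<noteq> y" for x y
    proof -
      \<comment> \<open>The test needs a one that only the first string has; if only
        \<open>y\<close> has one, the roles are swapped.\<close>
      have "\<exists>a. (a \<in> ones x) \<noteq> (a \<in> ones y)"
        using xy by (auto simp: X_def ones_def list_eq_iff_nth_eq)
      then consider a where "a \<in> ones x" "a \<notin> ones y" | a where "a \<in> ones y" "a \<notin> ones x" by blast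
      then show ?thesis
        using test[OF xy(1,2)] test[OF xy(2,1)] by cases (auto simp: abs_minus_commute)
    qed
    obtain recover where rec: "\<And>x. x \<in> X \<Longrightarrow>
        measure_pmf.prob (replicate_pmf (N n) (trace_pmf p x)) {ts. recover ts = x}
        \<ge> 1 - real (card X) * (2 * exp (- real (N n) * \<epsilon>\<^sup>2 / 2))"
      using recovery_from_tests[of X "N n" \<epsilon> "trace_pmf p"] test' finite_subset[OF sub U(1)] False
      by (auto simp: N_def \<epsilon>_def)
    have "((8 * real n) ^ (5 * b + 1))\<^sup>2 = (8 * real n) ^ (10 * b + 2)"
      by (subst power_mult[symmetric]) (rule arg_cong[of _ _ "power _"], simp)
    then have "\<epsilon>\<^sup>2 = 1 / (8 * real n) ^ (10 * b + 2)" by (simp only: \<epsilon>_def power_divide power_one)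
    moreover have "real (N n) = 4 * real n * (8 * real n) ^ (10 * b + 2)"
      by (simp only: N_def of_nat_mult of_nat_power of_nat_numeral)
    ultimately have "real (N n) * \<epsilon>\<^sup>2 = 4 * real n" using False by simp
    moreover have "real (card X) \<le> 2 ^ n" using card_mono[OF U(1) sub] U(2) by (simp flip: of_nat_le_iff)
    ultimately have "real (card X) * (2 * exp (- real (N n) * \<epsilon>\<^sup>2 / 2)) \<le> 2 ^ n * (2 * exp (- 2 * real n))"
      by (intro mult_mono) auto
    also have "\<dots> = \<delta> n"
      using False by (simp add: \<delta>_def power_mult_distrib exp_of_nat2_mult mult.commute flip: exp_of_nat_mult)
    finally have "1 - \<delta> n \<le> measure_pmf.prob (traces_pmf p (N n) x) {ts. recover ts = x}" if "x \<in> X" for x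
      using rec[OF that] by (simp add: traces_pmf_def)
    then show ?thesis by (auto simp: X_def)
  qed (simp add: \<delta>_def)
  ultimately show ?thesis by blast
qed

end
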